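(* Let $\gamma\in\mathcal{C}(T)$ be an essential curve on the once-punctured torus $T$. Let $\Gamma \subseteq T_\gamma$ be a maximal stable subtree. There exist $(P,Q,K)\in\mathbb{Z}^2_{\geq1}\times \mathbb{Z}_{\geq0}$ and $L_0\in\mathbb{Z}_{\geq1}$ such that, for all integers $L\geq L_0$, we have \[ \# \{ \alpha \in \Gamma \mid \ell(\alpha) = L \} = \varphi_{P, Q}(L - 4 K) + C(L), \] where \[ \varphi_{P, Q}(L) := \# \{ (x, y) \in \mathbb{Z}_{>0}^2 \mid Px + Qy = L, \ \gcd(x, y) = 1 \}, \] and $C(L)\in\{-2,\ldots,2\}$ is an explicit periodic function with period at most $\mathrm{lcm}(P,Q)$.
   Context: $T$ is a once-punctured topological torus. A curve is a free homotopy class of an unoriented closed curve on $T$; $\mathcal{C}(T)$ is the set of curves. $\pi_1(T)$ is free of rank $2$ on $\mathtt{a},\mathtt{b}$, $\mathtt{A}=\mathtt{a}^{-1}$, $\mathtt{B}=\mathtt{b}^{-1}$, and $\mathcal{C}(T)$ is in bijection with conjugacy classes of $\pi_1(T)$ up to inversion. A curve is essential if it is neither null-homotopic nor a power of a loop around the puncture. $\ell(\gamma)$ is the number of letters of a cyclically reduced word in $\{\mathtt{a},\mathtt{b},\mathtt{A},\mathtt{B}\}$ representing $\gamma$. The mapping classes $L,R\in\mathrm{Mod}(T)$ (Dehn twists) act on words by $L:\mathtt{a}\mapsto\mathtt{a},\mathtt{b}\mapsto\mathtt{ab}$ and $R:\mathtt{a}\mapsto\mathtt{ab},\mathtt{b}\mapsto\mathtt{b}$;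 $\langle L,R\rangle_+$ is the free semigroup of positive products of $L$ and $R$ (including the identity). $T_\gamma:=\langle L,R\rangle_+\cdot\gamma$ is seen as an infinite binary tree rooted at $\gamma$, with vertices labelled by curves and edges corresponding to the $L$- and $R$-actions (the vertex labelled $M\gamma$ reached by $M\in\langle L,R\rangle_+$ has children labelled $LM\gamma$ and $RM\gamma$); vertices labelled by the same curve are not identified. A word in $\{\mathtt{a},\mathtt{b},\mathtt{A},\mathtt{B}\}$ is monotone if it uses only letters of $\{\mathtt a,\mathtt b\}$ or only letters of $\{\mathtt A,\mathtt B\}$. Put $\mathtt{z}:=\mathtt{aBAb}$. A curve is stable if one of its representatives in $\pi_1(T)$ can be written as $\prod_{i=1}^n \mathtt{z}^{e_i}w_i$, with $e_i\in\mathbb{Z}$, all $e_i\neq0$ when $n>1$, and all $w_i$ non-empty monotone words. A subtree of $T_\gamma$ is stable if all of its vertices are stable (labelled by stable curves); maximal stable means maximal under inclusion among stable subtrees. In the claim, the letter $L$ denotes an integer length.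
   Formalization: The count is of distinct curves labelling vertices of Γ; the same formula for vertices is asserted only when their number is finite, as it is infinite e.g. for γ = a (La = a). The function C is asserted to exist, without an explicit formula. *)

theory Defs
  imports Main
begin

text \<open>
  The fundamental group of the once-punctured torus is the free group on two generators.  Its
  elements are represented by (not necessarily reduced) words in the letters a, b and their formal
  inverses A, B, and two words are equal in the group iff they are related by \<^term>\<open>free_eq\<close> below.
\<close>

datatype letter = la | lb | lA | lB

type_synonym word = "letter list"

fun letter_inv :: "letter \<Rightarrow> letter" where
  "letter_inv la = lA"
| "letter_inv lb = lB"
| "letter_inv lA = la"
| "letter_inv lB = lb"

definition word_inv :: "word \<Rightarrow> word" where
  "word_inv w = rev (map letter_inv w)"

definition word_pow :: "word \<Rightarrow> int \<Rightarrow> word" where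
  "word_pow w k = concat (replicate (nat \<bar>k\<bar>) (if k \<ge> 0 then w else word_inv w))"

definition cancels :: "word \<Rightarrow> word \<Rightarrow> bool" where
  "cancels u v \<longleftrightarrow> (\<exists>x y l. u = x @ [l, letter_inv l] @ y \<and> v = x @ y)"

definition free_eq :: "word \<Rightarrow> word \<Rightarrow> bool" where
  "free_eq = equivclp cancels"

definition curve_eq :: "word \<Rightarrow> word \<Rightarrow> bool" where
  "curve_eq u v \<longleftrightarrow>
     (\<exists>g. free_eq v (g @ u @ word_inv g) \<or> free_eq v (g @ word_inv u @ word_inv g))"

lemma letter_inv_inv [simp]: "letter_inv (letter_inv l) = l"
  by (cases l) auto

lemma word_inv_append [simp]: "word_inv (u @ v) = word_inv v @ word_inv u"
  by (simp add: word_inv_def)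

lemma word_inv_Nil [simp]: "word_inv [] = []"
  by (simp add: word_inv_def)

lemma word_inv_inv [simp]: "word_inv (word_inv u) = u"
  by (simp add: word_inv_def rev_map comp_def)

lemma free_eq_refl [simp, intro]: "free_eq u u"
  by (simp add: free_eq_def)

lemma free_eq_sym: "free_eq u v \<Longrightarrow> free_eq v u"
  by (simp add: free_eq_def equivclp_sym)

lemma free_eq_trans [trans]: "free_eq u v \<Longrightarrow> free_eq v w \<Longrightarrow> free_eq u w"
  unfolding free_eq_def by (rule equivclp_trans)

lemma free_eq_cancels: "cancels u v \<Longrightarrow> free_eq u v"
  unfolding free_eq_def by (rule r_into_equivclp)

lemma free_eq_map:
  assumes step: "\<And>u v. cancels u v \<Longrightarrow> free_eq (f u) (f v)"
    and "free_eq u v"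
  shows "free_eq (f u) (f v)"
  using assms(2) unfolding free_eq_def
proof (induction rule: equivclp_induct)
  case base
  show ?case by simp
next
  case (step y z)
  have "free_eq (f y) (f z)"
    using step(2) assms(1) free_eq_sym by blast
  with step(3) show ?case
    unfolding free_eq_def by (meson equivclp_trans)
qed

lemma cancels_ctxt: "cancels u v \<Longrightarrow> cancels (x @ u @ y) (x @ v @ y)"
  unfolding cancels_def
  by (elim exE conjE, rule_tac x = "x @ xa" in exI, rule_tac x = "ya @ y" in exI) auto

lemma free_eq_ctxt: "free_eq u v \<Longrightarrow> free_eq (x @ u @ y) (x @ v @ y)"
  by (rule free_eq_map[where f = "\<lambda>w. x @ w @ y"]) (auto intro: free_eq_cancels cancels_ctxt)

lemma free_eq_inv:
  assumes "free_eq u v"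
  shows "free_eq (word_inv u) (word_inv v)"
proof (rule free_eq_map[OF _ assms])
  fix u v :: word
  assume "cancels u v"
  then obtain x y l where "u = x @ [l, letter_inv l] @ y" "v = x @ y"
    unfolding cancels_def by blast
  then have "word_inv u = word_inv y @ [l, letter_inv l] @ word_inv x"
    and "word_inv v = word_inv y @ word_inv x"
    by (simp_all add: word_inv_def)
  then show "free_eq (word_inv u) (word_inv v)"
    by (intro free_eq_cancels) (auto simp: cancels_def)
qed

lemma free_eq_inv_right: "free_eq (u @ word_inv u) []"
proof (induction u)
  case Nil
  show ?case by simp
next
  case (Cons l u)
  have "free_eq ([l] @ (u @ word_inv u) @ [letter_inv l]) ([l] @ [] @ [letter_inv l])"
    by (rule free_eq_ctxt[OF Cons.IH])
  moreover have "free_eq [l, letter_inv l] []"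
    by (rule free_eq_cancels) (auto simp: cancels_def)
  ultimately show ?case
    using free_eq_trans by (simp add: word_inv_def)
qed

lemma free_eq_inv_left: "free_eq (word_inv u @ u) []"
  using free_eq_inv_right[of "word_inv u"] by simp

lemma free_eq_conj_cancel: "free_eq (word_inv g @ (g @ u @ word_inv g) @ g) u"
proof -
  have "free_eq ([] @ (word_inv g @ g) @ (u @ word_inv g @ g)) ([] @ [] @ (u @ word_inv g @ g))"
    by (rule free_eq_ctxt[OF free_eq_inv_left])
  moreover have "free_eq (u @ (word_inv g @ g) @ []) (u @ [] @ [])"
    by (rule free_eq_ctxt[OF free_eq_inv_left])
  ultimately show ?thesis
    using free_eq_trans by simp
qed

lemma curve_eq_refl: "curve_eq u u"
  unfolding curve_eq_def by (rule exI[of _ "[]"]) simp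

lemma curve_eq_sym:
  assumes "curve_eq u v"
  shows "curve_eq v u"
proof -
  obtain g u' where u': "u' = u \<or> u' = word_inv u" and "free_eq v (g @ u' @ word_inv g)"
    using assms unfolding curve_eq_def by blast
  then have "free_eq (word_inv g @ v @ g) (word_inv g @ (g @ u' @ word_inv g) @ g)"
    by (intro free_eq_ctxt)
  then have *: "free_eq (word_inv g @ v @ g) u'"
    using free_eq_conj_cancel free_eq_trans by blast
  from u' show ?thesis
  proof
    assume "u' = u"
    then show ?thesis
      unfolding curve_eq_def using free_eq_sym[OF *] by (intro exI[of _ "word_inv g"]) simp
  next
    assume "u' = word_inv u"
    then have "free_eq u (word_inv g @ word_inv v @ g)"
      using free_eq_sym[OF free_eq_inv[OF *]] by simp
    then show ?thesis
      unfolding curve_eq_def by (intro exI[of _ "word_inv g"]) simp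
  qed
qed

lemma curve_eq_trans:
  assumes "curve_eq u v" "curve_eq v w"
  shows "curve_eq u w"
proof -
  obtain g u' where u': "u' = u \<or> u' = word_inv u" and g: "free_eq v (g @ u' @ word_inv g)"
    using assms(1) unfolding curve_eq_def by blast
  obtain h v' where v': "v' = v \<or> v' = word_inv v" and h: "free_eq w (h @ v' @ word_inv h)"
    using assms(2) unfolding curve_eq_def by blast
  have "\<exists>u''. (u'' = u \<or> u'' = word_inv u) \<and> free_eq v' (g @ u'' @ word_inv g)"
    using v' u' g free_eq_inv[OF g] by (elim disjE) auto
  then obtain u'' where u'': "u'' = u \<or> u'' = word_inv u"
    and "free_eq v' (g @ u'' @ word_inv g)"
    by blast
  then have "free_eq (h @ v' @ word_inv h) (h @ (g @ u'' @ word_inv g) @ word_inv h)"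
    by (intro free_eq_ctxt)
  then have "free_eq w ((h @ g) @ u'' @ word_inv (h @ g))"
    using h free_eq_trans by simp
  then show ?thesis
    unfolding curve_eq_def using u'' by blast
qed

text \<open>Conjugacy classes of the free group up to inversion.\<close>

quotient_type curve = word / curve_eq
  morphisms rep_curve curve_of
  by (intro equivpI reflpI sympI transpI) (blast intro: curve_eq_refl curve_eq_sym curve_eq_trans)+

text \<open>
  The loop around the puncture is represented by the commutator abAB; its inverse baBA is conjugate
  to the word z = aBAb used in the definition of stability.
\<close>

definition essential :: "curve \<Rightarrow> bool" where
  "essential \<gamma> \<longleftrightarrow>
     \<gamma> \<noteq> curve_of [] \<and> (\<forall>k::int. \<gamma> \<noteq> curve_of (word_pow [la, lb, lA, lB] k))"

definition cyclically_reduced :: "word \<Rightarrow> bool" where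
  "cyclically_reduced w \<longleftrightarrow>
     (\<forall>i < length w. w ! (Suc i mod length w) \<noteq> letter_inv (w ! i))"

text \<open>All cyclically reduced representatives of a curve have the same length.\<close>

definition curve_length :: "curve \<Rightarrow> nat" where
  "curve_length \<gamma> = (THE n. \<exists>w. curve_of w = \<gamma> \<and> cyclically_reduced w \<and> length w = n)"

datatype twist = TL | TR

fun twist_letter :: "twist \<Rightarrow> letter \<Rightarrow> word" where
  "twist_letter TL la = [la]"
| "twist_letter TL lb = [la, lb]"
| "twist_letter TL lA = [lA]"
| "twist_letter TL lB = [lB, lA]"
| "twist_letter TR la = [la, lb]"
| "twist_letter TR lb = [lb]"
| "twist_letter TR lA = [lB, lA]"
| "twist_letter TR lB = [lB]"

definition twist_word :: "twist \<Rightarrow> word \<Rightarrow> word" where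
  "twist_word m w = concat (map (twist_letter m) w)"

lemma twist_letter_inv: "twist_letter m (letter_inv l) = word_inv (twist_letter m l)"
  by (cases m; cases l) (simp_all add: word_inv_def)

lemma twist_word_append [simp]: "twist_word m (u @ v) = twist_word m u @ twist_word m v"
  by (simp add: twist_word_def)

lemma twist_word_inv: "twist_word m (word_inv w) = word_inv (twist_word m w)"
  by (induction w) (simp_all add: word_inv_def twist_word_def twist_letter_inv)

lemma twist_word_free_eq:
  assumes "free_eq u v"
  shows "free_eq (twist_word m u) (twist_word m v)"
proof (rule free_eq_map[OF _ assms])
  fix u v :: word
  assume "cancels u v"
  then obtain x y l where uv: "u = x @ [l, letter_inv l] @ y" "v = x @ y"
    unfolding cancels_def by blast
  have "free_eq (twist_word m x @ (twist_letter m l @ word_inv (twist_letter m l)) @ twist_word m y)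
          (twist_word m x @ [] @ twist_word m y)"
    by (rule free_eq_ctxt[OF free_eq_inv_right])
  then show "free_eq (twist_word m u) (twist_word m v)"
    by (simp add: uv twist_word_def twist_letter_inv)
qed

lift_definition twist_curve :: "twist \<Rightarrow> curve \<Rightarrow> curve" is twist_word
proof -
  fix m u v
  assume "curve_eq u v"
  then obtain g where "free_eq v (g @ u @ word_inv g) \<or> free_eq v (g @ word_inv u @ word_inv g)"
    unfolding curve_eq_def by blast
  then show "curve_eq (twist_word m u) (twist_word m v)"
    unfolding curve_eq_def
    by (intro exI[of _ "twist_word m g"]) (auto dest: twist_word_free_eq[of _ _ m]
        simp: twist_word_inv)
qed

text \<open>
  The semigroup of positive products of the two twists is free, so the vertices of the tree of
  \<open>\<gamma>\<close> are encoded as words in the twists: the list [m1, ..., mk] is the product m1 ... mk, the empty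
  list is the root, and the children of v are TL # v and TR # v.  Distinct lists are distinct
  vertices, even when their labels are equal.
\<close>

type_synonym vertex = "twist list"

definition vertex_label :: "curve \<Rightarrow> vertex \<Rightarrow> curve" where
  "vertex_label \<gamma> v = foldr twist_curve v \<gamma>"

definition adjacent :: "vertex \<Rightarrow> vertex \<Rightarrow> bool" where
  "adjacent u v \<longleftrightarrow> (\<exists>m. v = m # u \<or> u = m # v)"

text \<open>A subtree is a non-empty connected subgraph; it is determined by its set of vertices.\<close>

definition subtree :: "vertex set \<Rightarrow> bool" where
  "subtree S \<longleftrightarrow>
     S \<noteq> {} \<and> (\<forall>u\<in>S. \<forall>v\<in>S. (\<lambda>x y. x \<in> S \<and> y \<in> S \<and> adjacent x y)\<^sup>*\<^sup>* u v)"

definition monotone_word :: "word \<Rightarrow> bool" where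
  "monotone_word w \<longleftrightarrow> set w \<subseteq> {la, lb} \<or> set w \<subseteq> {lA, lB}"

definition z_word :: word where
  "z_word = [la, lB, lA, lb]"

text \<open>The list \<open>ps\<close> consists of the pairs (e1, w1), ..., (en, wn).\<close>

definition stable :: "curve \<Rightarrow> bool" where
  "stable \<gamma> \<longleftrightarrow> (\<exists>ps :: (int \<times> word) list.
     ps \<noteq> [] \<and>
     (length ps > 1 \<longrightarrow> (\<forall>(e, w) \<in> set ps. e \<noteq> 0)) \<and>
     (\<forall>(e, w) \<in> set ps. w \<noteq> [] \<and> monotone_word w) \<and>
     \<gamma> = curve_of (concat (map (\<lambda>(e, w). word_pow z_word e @ w) ps)))"

definition stable_subtree :: "curve \<Rightarrow> vertex set \<Rightarrow> bool" where
  "stable_subtree \<gamma> S \<longleftrightarrow> subtree S \<and> (\<forall>v\<in>S. stable (vertex_label \<gamma> v))"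

definition maximal_stable_subtree :: "curve \<Rightarrow> vertex set \<Rightarrow> bool" where
  "maximal_stable_subtree \<gamma> S \<longleftrightarrow>
     stable_subtree \<gamma> S \<and> (\<forall>S'. stable_subtree \<gamma> S' \<and> S \<subseteq> S' \<longrightarrow> S' = S)"

definition phi :: "int \<Rightarrow> int \<Rightarrow> int \<Rightarrow> nat" where
  "phi P Q L = card {(x :: int, y :: int). x > 0 \<and> y > 0 \<and> P * x + Q * y = L \<and> gcd x y = 1}"

text \<open>
  The vertices of \<open>\<Gamma>\<close> whose label has length L; the set of their labels is the set of curves
  \<open>\<alpha> \<in> \<Gamma>\<close> of length L.  The latter is always finite, since there are finitely many words of given
  length.  The former may be infinite: if \<open>\<gamma>\<close> is the curve a, then every vertex in the infinite
  branch [], [TL], [TL, TL], ... has label a.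
\<close>

definition vertices_of_length :: "curve \<Rightarrow> vertex set \<Rightarrow> int \<Rightarrow> vertex set" where
  "vertices_of_length \<gamma> \<Gamma> L = {v \<in> \<Gamma>. int (curve_length (vertex_label \<gamma> v)) = L}"

end

(*
A twist fixes z, so applying a positive product M of twists to a stable word only replaces each
monotone piece w by M w.  Once both twists occur in M, every M w has the form a u b or B u A, and
then letters cancel only where the sign changes, one pair each time; half of these pairs are a's
and half are b's.  Hence the length is 4 K plus the length of M w summed over the pieces, where K
does not depend on M.  If the pieces have p letters a, A and q letters b, B in total, this
sum is p |M a| + q |M b|, and (|M a|, |M b|) runs through all pairs of coprime positive integers,
each taken once.  The powers of a single twist have lengths that are eventually linear with slope
q or p, but with other constants; these progressions give C.  If p = 0 or q = 0, one of the twists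
fixes the curve and the count reduces to the image under the other twist.
*)
theory Submission
  imports Defs
begin

subsection \<open>Reduced words and the length of a curve\<close>

text \<open>The length is read off from explicit cyclically reduced words, so one must know exactly
  where cancellation stops. Since z = a BA b and its inverse B ab A begin and end like the words a u
  b and B u A, one calculus of signed blocks covers the pieces and the powers of z. What is lost or
  gained depends only on the cyclic sequence of signs and z-marks, which twists preserve; hence one
  K serves all generic M. The obstacle is the powers of a single twist, whose pieces may lack these
  end letters. Their lengths are never computed exactly: the intercept of an eventually linear
  length only selects a residue class, and the slope is found by squeezing. Starting from the count
  of all vertices by the generic formula, two residue classes are exchanged for two others with the
  same moduli; this yields the bound 2 and the period. Counting curves instead of vertices is
  harmless when the pieces contain both kinds of letters: the numbers of letters a, A and of letters
  b, B are invariants of a curve, and they separate the vertices after two further twists.\<close>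

definition reduced :: "word \<Rightarrow> bool" where
  "reduced = successively (\<lambda>x y. y \<noteq> letter_inv x)"

fun push :: "letter \<Rightarrow> word \<Rightarrow> word" where
  "push l [] = [l]"
| "push l (x # xs) = (if x = letter_inv l then xs else l # x # xs)"

definition normal_form :: "word \<Rightarrow> word" where
  "normal_form w = foldr push w []"

lemma letter_inv_neq [simp]: "letter_inv l \<noteq> l" "l \<noteq> letter_inv l"
  by (cases l; simp)+

lemma word_inv_Cons: "word_inv (l # w) = word_inv w @ [letter_inv l]"
  by (simp add: word_inv_def)

lemma reduced_append_iff:
  "reduced (u @ v) \<longleftrightarrow>
     reduced u \<and> reduced v \<and> (u = [] \<or> v = [] \<or> hd v \<noteq> letter_inv (last u))"
  by (simp add: reduced_def successively_append_iff)

lemma reduced_Nil [simp]: "reduced []"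
  by (simp add: reduced_def)

lemma reduced_Cons: "reduced (l # w) \<longleftrightarrow> w = [] \<or> (hd w \<noteq> letter_inv l \<and> reduced w)"
  by (cases w) (auto simp: reduced_def)

lemma reduced_push: "reduced w \<Longrightarrow> reduced (push l w)"
  by (cases w) (auto simp: reduced_Cons)

lemma reduced_normal_form: "reduced (normal_form w)"
  unfolding normal_form_def by (induction w) (auto intro: reduced_push)

text \<open>Van der Waerden's argument: pushing letters makes the free group act on reduced words,
  so the normal form is constant on \<open>free_eq\<close> classes.\<close>

lemma push_push_inv: "reduced w \<Longrightarrow> push l (push (letter_inv l) w) = w"
proof (cases w)
  case (Cons x xs)
  moreover assume "reduced w"
  ultimately show ?thesis by (cases xs) (auto simp: reduced_Cons)
qed simp

lemma normal_form_reduced: "reduced w \<Longrightarrow> normal_form w = w"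
proof (induction w)
  case (Cons l w)
  then have "normal_form (l # w) = push l w"
    by (auto simp: normal_form_def reduced_Cons)
  with Cons.prems show ?case by (cases w) (auto simp: reduced_Cons)
qed (simp add: normal_form_def)

lemma normal_form_free_eq:
  assumes "free_eq u v"
  shows "normal_form u = normal_form v"
proof -
  have step: "normal_form u = normal_form v" if *: "cancels u v" for u v
  proof -
    obtain x y l where "u = x @ [l, letter_inv l] @ y" "v = x @ y"
      using * unfolding cancels_def by blast
    then show ?thesis
      using push_push_inv[OF reduced_normal_form[of y]] by (simp add: normal_form_def)
  qed
  show ?thesis
    using assms unfolding free_eq_def
    by (induction rule: equivclp_induct) (auto dest: step)
qed

text \<open>The predicate \<open>P\<close> is kept general because the bounds serve twice: for the
  length, and for the separate numbers of letters a, A and b, B, which tell curves apart.\<close>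

lemma length_filter_push:
  "length (filter P (push l w)) \<le> length (filter P (l # w))"
  by (cases w) auto

lemma length_filter_normal_form:
  "length (filter P (normal_form w)) \<le> length (filter P w)"
proof (induction w)
  case (Cons l w)
  have "length (filter P (push l (normal_form w))) \<le> length (filter P (l # normal_form w))"
    by (rule length_filter_push)
  also have "\<dots> \<le> length (filter P (l # w))"
    using Cons by simp
  finally show ?case by (simp add: normal_form_def)
qed (simp add: normal_form_def)

lemma length_filter_reduced_le:
  assumes "reduced u" "free_eq u v"
  shows "length (filter P u) \<le> length (filter P v)"
  using length_filter_normal_form[of P v] normal_form_free_eq[OF assms(2)]
    normal_form_reduced[OF assms(1)] by simp

lemma free_eq_append:
  assumes "free_eq u u'" "free_eq v v'"
  shows "free_eq (u @ v) (u' @ v')"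
proof -
  have "free_eq (u @ v) (u' @ v)" using free_eq_ctxt[OF assms(1), of "[]" v] by simp
  also have "free_eq \<dots> (u' @ v')" using free_eq_ctxt[OF assms(2), of u' "[]"] by simp
  finally show ?thesis .
qed

lemma length_filter_word_inv:
  assumes "\<And>l. P (letter_inv l) = P l"
  shows "length (filter P (word_inv w)) = length (filter P w)"
  by (induction w) (auto simp: word_inv_Cons assms)

lemma reduced_concat_replicate:
  assumes "reduced (w @ w)"
  shows "reduced (concat (replicate n w))"
proof (induction n)
  case (Suc n)
  then show ?case using assms by (cases n) (auto simp: reduced_append_iff)
qed simp

lemma free_eq_conj_power:
  assumes "free_eq u (g @ v @ word_inv g)"
  shows "free_eq (concat (replicate n u)) (g @ concat (replicate n v) @ word_inv g)"
proof (induction n)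
  case 0
  show ?case using free_eq_sym[OF free_eq_inv_right[of g]] by simp
next
  case (Suc n)
  have "free_eq (concat (replicate (Suc n) u))
          ((g @ v @ word_inv g) @ (g @ concat (replicate n v) @ word_inv g))"
    using free_eq_append[OF assms Suc] by simp
  also have "free_eq \<dots> (g @ concat (replicate (Suc n) v) @ word_inv g)"
    using free_eq_ctxt[OF free_eq_inv_left[of g], of "g @ v" "concat (replicate n v) @ word_inv g"]
    by simp
  finally show ?case .
qed

section \<open>Curves and their cyclically reduced words\<close>

lemma curve_of_eq_iff: "curve_of u = curve_of v \<longleftrightarrow> curve_eq u v"
  by (simp add: curve.abs_eq_iff)

lemma curve_of_free_eq: "free_eq u v \<Longrightarrow> curve_of u = curve_of v"
  unfolding curve_of_eq_iff curve_eq_def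
  by (rule exI[of _ "[]"]) (simp add: free_eq_sym)

lemma curve_of_conj:
  assumes "free_eq (u @ g) (g @ v)"
  shows "curve_of u = curve_of v"
proof -
  have "free_eq (u @ [] @ []) (u @ (g @ word_inv g) @ [])"
    by (rule free_eq_ctxt[OF free_eq_sym[OF free_eq_inv_right]])
  also have "free_eq \<dots> (g @ v @ word_inv g)"
    using free_eq_ctxt[OF assms, of "[]" "word_inv g"] by simp
  finally have "free_eq u (g @ v @ word_inv g)" by simp
  then have "curve_eq v u" unfolding curve_eq_def by blast
  then show ?thesis by (simp add: curve_of_eq_iff curve_eq_sym)
qed

lemma curve_of_rotate: "curve_of (u @ v) = curve_of (v @ u)"
  by (rule curve_of_conj[of _ u]) simp

text \<open>
  The powers of a cyclically reduced word \<open>u\<close> are reduced, so conjugating by \<open>g\<close> gives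
  \<open>n |u| \<le> n |v| + 2 |g|\<close> for all \<open>n\<close>.
\<close>

lemma length_filter_cyclically_reduced_le:
  assumes red: "reduced (u @ u)" and eq: "curve_of u = curve_of v"
    and P: "\<And>l. P (letter_inv l) = P l"
  shows "length (filter P u) \<le> length (filter P v)"
proof -
  have "curve_eq v u" using eq by (simp add: curve_of_eq_iff curve_eq_sym)
  then obtain g v' where v': "v' = v \<or> v' = word_inv v"
    and g: "free_eq u (g @ v' @ word_inv g)"
    unfolding curve_eq_def by blast
  let ?c = "\<lambda>w. length (filter P w)"
  have power: "?c (concat (replicate n w)) = n * ?c w" for n w
    by (induction n) auto
  have v'c: "?c v' = ?c v" using v' length_filter_word_inv[of P, OF P] by auto
  have bound: "n * ?c u \<le> n * ?c v + 2 * ?c g" for n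
    using length_filter_reduced_le[OF reduced_concat_replicate[OF red, of n]
        free_eq_conj_power[OF g, of n], of P] v'c
    by (simp add: power length_filter_word_inv[of P, OF P])
  show ?thesis
  proof (rule ccontr)
    assume "\<not> ?thesis"
    \<comment> \<open>For n = 2 |g| + 1 the bound would read n (|v| + 1) <= n |v| + 2 |g|, that is n
      <= 2 |g|.\<close>
    then have "(2 * ?c g + 1) * (?c v + 1) \<le> (2 * ?c g + 1) * ?c u"
      by (intro mult_le_mono) auto
    with bound[of "2 * ?c g + 1"] show False by simp
  qed
qed

lemma length_filter_cyclically_reduced_eq:
  assumes "reduced (u @ u)" "reduced (v @ v)" "curve_of u = curve_of v"
    and "\<And>l. P (letter_inv l) = P l"
  shows "length (filter P u) = length (filter P v)"
  using length_filter_cyclically_reduced_le[of _ _ P, OF assms(1,3,4)]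
    length_filter_cyclically_reduced_le[of _ _ P, OF assms(2) assms(3)[symmetric] assms(4)]
  by (rule order_antisym)

text \<open>The seam between the two copies of \<open>w\<close> is the cyclic step from the last
  letter to the first; this form replaces indices modulo the length by the append rule for
  \<open>reduced\<close>.\<close>

lemma cyclically_reduced_iff: "cyclically_reduced w \<longleftrightarrow> reduced (w @ w)"
proof (cases "w = []")
  case False
  let ?n = "length w"
  have lin: "reduced w \<longleftrightarrow> (\<forall>i. Suc i < ?n \<longrightarrow> w ! Suc i \<noteq> letter_inv (w ! i))"
    unfolding reduced_def successively_conv_nth by simp
  have "cyclically_reduced w \<longleftrightarrow> (\<forall>i. Suc i < ?n \<longrightarrow> w ! Suc i \<noteq> letter_inv (w ! i)) \<and>
      w ! 0 \<noteq> letter_inv (w ! (?n - 1))" (is "_ \<longleftrightarrow> ?rhs")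
  proof
    assume *: "cyclically_reduced w"
    have "w ! Suc i \<noteq> letter_inv (w ! i)" if "Suc i < ?n" for i
      using * that unfolding cyclically_reduced_def by (auto dest: spec[of _ i])
    moreover have "w ! 0 \<noteq> letter_inv (w ! (?n - 1))"
      using * False unfolding cyclically_reduced_def by (auto dest: spec[of _ "?n - 1"])
    ultimately show ?rhs by blast
  next
    assume *: ?rhs
    show "cyclically_reduced w"
      unfolding cyclically_reduced_def
    proof (intro allI impI)
      fix i assume "i < ?n"
      show "w ! (Suc i mod ?n) \<noteq> letter_inv (w ! i)"
      proof (cases "Suc i < ?n")
        case True
        with * show ?thesis by simp
      next
        case no: False
        with \<open>i < ?n\<close> have "?n = Suc i" by simp
        with * show ?thesis by simp
      qed
    qed
  qed
  with lin False show ?thesis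
    by (auto simp: reduced_append_iff hd_conv_nth last_conv_nth)
qed (simp add: cyclically_reduced_def)

lemma curve_length_eq:
  assumes "reduced (w @ w)" "curve_of w = \<gamma>"
  shows "curve_length \<gamma> = length w"
  unfolding curve_length_def
proof (rule the_equality)
  show "\<exists>v. curve_of v = \<gamma> \<and> cyclically_reduced v \<and> length v = length w"
    using assms by (auto simp: cyclically_reduced_iff)
next
  fix n
  assume "\<exists>v. curve_of v = \<gamma> \<and> cyclically_reduced v \<and> length v = n"
  then obtain v where v: "curve_of v = curve_of w" "reduced (v @ v)" "length v = n"
    by (auto simp: assms(2) cyclically_reduced_iff)
  show "n = length w"
    using length_filter_cyclically_reduced_eq[OF v(2) assms(1) v(1), of "\<lambda>_. True"] v(3) by simp
qed

text \<open>A shortest representative works: a cancelling pair inside it, or one formed by its last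
  and first letters after rotation, would give a shorter one.\<close>

lemma cyclically_reduced_representative:
  obtains w where "reduced (w @ w)" "curve_of w = \<gamma>"
proof -
  have "\<exists>w. curve_of w = \<gamma>" by (induct \<gamma> rule: curve.abs_induct) auto
  then obtain w where w: "curve_of w = \<gamma>" and
    min: "\<And>v. curve_of v = \<gamma> \<Longrightarrow> length w \<le> length v"
    using ex_has_least_nat[of "\<lambda>w. curve_of w = \<gamma>" _ length] by metis
  have "reduced w"
  proof (rule ccontr)
    assume "\<not> reduced w"
    then obtain i where i: "Suc i < length w" "w ! Suc i = letter_inv (w ! i)"
      unfolding reduced_def successively_conv_nth by auto
    have "w = take i w @ [w ! i, w ! Suc i] @ drop (Suc (Suc i)) w"
      using i(1) by (metis Cons_nth_drop_Suc Suc_lessD append_Cons append_Nil append_take_drop_id)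
    then have "cancels w (take i w @ drop (Suc (Suc i)) w)"
      unfolding cancels_def using i(2) by metis
    then have "curve_of (take i w @ drop (Suc (Suc i)) w) = \<gamma>"
      using w curve_of_free_eq[OF free_eq_cancels] by auto
    from min[OF this] i(1) show False by simp
  qed
  moreover have "w = [] \<or> hd w \<noteq> letter_inv (last w)"
  proof (rule ccontr)
    assume "\<not> ?thesis"
    then have ne: "w \<noteq> []" and hd: "hd w = letter_inv (last w)" by auto
    then have "tl w \<noteq> []"
      by (metis hd_Cons_tl last.simps letter_inv_neq(2))
    then have split: "w = (hd w # butlast (tl w)) @ [last w]"
      using ne by (metis append_Cons append_butlast_last_id hd_Cons_tl last_tl)
    have "\<gamma> = curve_of ([last w] @ [letter_inv (last w)] @ butlast (tl w))"
      using w split curve_of_rotate hd by (metis append_Cons append_Nil)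
    also have "\<dots> = curve_of (butlast (tl w))"
      by (rule curve_of_free_eq[OF free_eq_cancels])
        (simp add: cancels_def, metis append_Nil)
    finally have "length w \<le> length (butlast (tl w))" by (intro min) simp
    with ne show False by (cases w) auto
  qed
  ultimately show ?thesis
    using that[of w] w by (auto simp: reduced_append_iff)
qed

lemma curve_length_le: "curve_length (curve_of w) \<le> length w"
proof -
  obtain v where v: "reduced (v @ v)" "curve_of v = curve_of w"
    by (rule cyclically_reduced_representative)
  then show ?thesis
    using curve_length_eq[OF v] length_filter_cyclically_reduced_le[OF v, of "\<lambda>_. True"] by simp
qed

lemma twist_curve_of: "twist_curve m (curve_of w) = curve_of (twist_word m w)"
  by (rule twist_curve.abs_eq)

lemma length_twist_letter: "length (twist_letter m l) \<le> 2"
  by (cases m; cases l) auto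

text \<open>Crude, but it carries lower bounds on the length from a child to its parent, where no
  explicit reduced word is at hand.\<close>

lemma curve_length_twist_le: "curve_length (twist_curve m \<gamma>) \<le> 2 * curve_length \<gamma>"
proof -
  obtain w where w: "reduced (w @ w)" "curve_of w = \<gamma>"
    by (rule cyclically_reduced_representative)
  have "length (twist_word m w) \<le> 2 * length w"
  proof (induction w)
    case (Cons l w)
    then show ?case using length_twist_letter[of m l] by (simp add: twist_word_def)
  qed (simp add: twist_word_def)
  moreover have "curve_length (twist_curve m \<gamma>) \<le> length (twist_word m w)"
    using curve_length_le[of "twist_word m w"] by (simp add: twist_curve_of flip: w(2))
  ultimately show ?thesis
    using curve_length_eq[OF w] by simp
qed

subsection \<open>The action of twists on stable words\<close>

definition twists :: "vertex \<Rightarrow> word \<Rightarrow> word" where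
  "twists u = foldr twist_word u"

lemma twists_simps [simp]:
  "twists [] w = w" "twists (m # u) w = twist_word m (twists u w)"
  "twists (u @ v) w = twists u (twists v w)"
  by (simp_all add: twists_def)

lemma twist_word_Nil [simp]: "twist_word m [] = []"
  by (simp add: twist_word_def)

lemma twist_word_Cons: "twist_word m (l # w) = twist_letter m l @ twist_word m w"
  by (simp add: twist_word_def)

lemma twists_Nil_word [simp]: "twists u [] = []"
  by (induction u) auto

lemma twists_append [simp]: "twists u (v @ w) = twists u v @ twists u w"
  by (induction u) auto

lemma vertex_label_simps [simp]:
  "vertex_label \<gamma> [] = \<gamma>" "vertex_label \<gamma> (m # u) = twist_curve m (vertex_label \<gamma> u)"
  "vertex_label \<gamma> (u @ v) = vertex_label (vertex_label \<gamma> v) u"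
  by (simp_all add: vertex_label_def)

lemma vertex_label_curve_of: "vertex_label (curve_of w) u = curve_of (twists u w)"
  by (induction u) (simp_all add: twist_curve_of)

lemma twists_word_inv: "twists u (word_inv w) = word_inv (twists u w)"
  by (induction u) (auto simp: twist_word_inv)

lemma twists_word_pow: "twists u (word_pow w k) = word_pow (twists u w) k"
proof -
  have "twists u (concat (replicate n v)) = concat (replicate n (twists u v))" for n v
    by (induction n) auto
  then show ?thesis by (simp add: word_pow_def twists_word_inv)
qed

lemma word_pow_free_eq:
  assumes "free_eq v w"
  shows "free_eq (word_pow v k) (word_pow w k)"
proof -
  have *: "free_eq (concat (replicate n x)) (concat (replicate n y))" if "free_eq x y" for n x y
    by (induction n) (auto intro: free_eq_append that)
  show ?thesis
    unfolding word_pow_def using *[OF assms] *[OF free_eq_inv[OF assms]] by auto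
qed

text \<open>The twists fix the group element z and not only its conjugacy class, so copies of z stay
  in place between the pieces of a stable word.\<close>

lemma twist_z_word: "free_eq (twist_word m z_word) z_word"
proof (cases m)
  case TL
  have "cancels (twist_word m z_word) z_word"
    unfolding cancels_def
    by (rule exI[of _ "[la, lB, lA]"], rule exI[of _ "[lb]"], rule exI[of _ lA])
      (simp add: TL z_word_def twist_word_def)
  then show ?thesis by (rule free_eq_cancels)
next
  case TR
  have "cancels (twist_word m z_word) z_word"
    unfolding cancels_def
    by (rule exI[of _ "[la]"], rule exI[of _ "[lB, lA, lb]"], rule exI[of _ lb])
      (simp add: TR z_word_def twist_word_def)
  then show ?thesis by (rule free_eq_cancels)
qed

lemma twists_z_word: "free_eq (twists u z_word) z_word"
  by (induction u) (auto intro: free_eq_trans twist_word_free_eq twist_z_word)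

definition stable_word :: "(int \<times> word) list \<Rightarrow> word" where
  "stable_word ps = concat (map (\<lambda>(e, w). word_pow z_word e @ w) ps)"

definition admissible :: "(int \<times> word) list \<Rightarrow> bool" where
  "admissible ps \<longleftrightarrow> ps \<noteq> [] \<and> (length ps > 1 \<longrightarrow> (\<forall>(e, w) \<in> set ps. e \<noteq> 0)) \<and>
     (\<forall>(e, w) \<in> set ps. w \<noteq> [] \<and> monotone_word w)"

lemma stable_iff: "stable \<gamma> \<longleftrightarrow> (\<exists>ps. admissible ps \<and> \<gamma> = curve_of (stable_word ps))"
  unfolding stable_def admissible_def stable_word_def by blast

lemma free_eq_twists_stable_word:
  "free_eq (twists u (stable_word ps)) (stable_word (map (map_prod id (twists u)) ps))"
proof (induction ps)
  case (Cons p ps)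
  obtain e w where p: "p = (e, w)" by fastforce
  have "free_eq (word_pow (twists u z_word) e @ twists u w) (word_pow z_word e @ twists u w)"
    by (intro free_eq_append word_pow_free_eq twists_z_word) simp
  with Cons show ?case
    using free_eq_append by (fastforce simp: stable_word_def p twists_word_pow)
qed (simp add: stable_word_def)

definition letters_of_sign :: "bool \<Rightarrow> letter set" where
  "letters_of_sign s = (if s then {la, lb} else {lA, lB})"

lemma monotone_word_iff: "monotone_word w \<longleftrightarrow> (\<exists>s. set w \<subseteq> letters_of_sign s)"
  unfolding monotone_word_def letters_of_sign_def by (simp add: ex_bool_eq)

lemma twist_letter_not_Nil [simp]: "twist_letter m l \<noteq> []"
  by (cases m; cases l) auto

lemma twists_eq_Nil_iff [simp]: "twists u w = [] \<longleftrightarrow> w = []"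
proof (induction u)
  case (Cons m u)
  have "twist_word m v = [] \<longleftrightarrow> v = []" for v
    by (cases v) (auto simp: twist_word_Cons)
  with Cons show ?case by simp
qed simp

lemma set_twist_letter:
  "l \<in> letters_of_sign s \<Longrightarrow> set (twist_letter m l) \<subseteq> letters_of_sign s"
  by (cases m; cases l) (auto simp: letters_of_sign_def split: if_splits)

lemma set_twists:
  assumes "set w \<subseteq> letters_of_sign s"
  shows "set (twists u w) \<subseteq> letters_of_sign s"
proof (induction u)
  case (Cons m u)
  then show ?case using set_twist_letter by (fastforce simp: twist_word_def)
qed (use assms in simp)

lemma admissible_twists:
  assumes "admissible ps"
  shows "admissible (map (map_prod id (twists u)) ps)"
proof -
  have "monotone_word (twists u w)" if "monotone_word w" for w
    using that set_twists unfolding monotone_word_iff by blast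
  with assms show ?thesis unfolding admissible_def by (auto simp: split_beta)
qed

section \<open>The shape of maximal stable subtrees\<close>

lemma stable_vertex_label:
  assumes "stable \<gamma>"
  shows "stable (vertex_label \<gamma> u)"
proof -
  obtain ps where "admissible ps" "\<gamma> = curve_of (stable_word ps)"
    using assms stable_iff by blast
  then show ?thesis
    using admissible_twists[of ps u] curve_of_free_eq[OF free_eq_twists_stable_word[of u ps]]
    unfolding stable_iff by (auto simp: vertex_label_curve_of)
qed

text \<open>A shallowest vertex \<open>v\<close> bounds the subtree: a path leaving the descendants
  of \<open>v\<close> would have to pass to the parent of \<open>v\<close>, which is shallower. All
  descendants of \<open>v\<close> inherit stability, so maximality forces them in.\<close>

lemma maximal_stable_subtree_eq:
  assumes "maximal_stable_subtree \<gamma> \<Gamma>"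
  obtains v where "\<Gamma> = range (\<lambda>u. u @ v)" "stable (vertex_label \<gamma> v)"
proof -
  have max: "\<And>S. stable_subtree \<gamma> S \<Longrightarrow> \<Gamma> \<subseteq> S \<Longrightarrow> S = \<Gamma>"
    and "stable_subtree \<gamma> \<Gamma>"
    using assms unfolding maximal_stable_subtree_def by blast+
  then have sub: "subtree \<Gamma>" and st: "\<And>v. v \<in> \<Gamma> \<Longrightarrow> stable (vertex_label \<gamma> v)"
    unfolding stable_subtree_def by blast+
  obtain v0 where "v0 \<in> \<Gamma>" using sub by (auto simp: subtree_def)
  then obtain v where v: "v \<in> \<Gamma>" and min: "\<And>u. u \<in> \<Gamma> \<Longrightarrow> length v \<le> length u"
    using ex_has_least_nat[of "\<lambda>u. u \<in> \<Gamma>" v0 length] by auto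
  define S where "S = range (\<lambda>u. u @ v)"
  let ?E = "\<lambda>x y. x \<in> S \<and> y \<in> S \<and> adjacent x y"
  have "\<Gamma> \<subseteq> S"
  proof
    fix u assume "u \<in> \<Gamma>"
    then have "(\<lambda>x y. x \<in> \<Gamma> \<and> y \<in> \<Gamma> \<and> adjacent x y)\<^sup>*\<^sup>* v u"
      using sub v by (auto simp: subtree_def)
    then show "u \<in> S"
    proof (induction rule: rtranclp_induct)
      case base
      show ?case unfolding S_def by (rule range_eqI[of _ _ "[]"]) simp
    next
      case (step x y)
      then obtain t where t: "x = t @ v" by (auto simp: S_def)
      from step(2) obtain m where "y = m # x \<or> x = m # y" by (auto simp: adjacent_def)
      then show ?case
      proof
        assume "y = m # x"
        then show ?thesis unfolding S_def t by (intro range_eqI[of _ _ "m # t"]) simp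
      next
        assume y: "x = m # y"
        have "length v \<le> length y" using min step(2) by blast
        with y t obtain t' where "t = m # t'" by (cases t) auto
        with y t show ?thesis unfolding S_def by (intro range_eqI[of _ _ t']) simp
      qed
    qed
  qed
  moreover have "stable_subtree \<gamma> S"
  proof -
    have down: "?E\<^sup>*\<^sup>* (u @ v) v" for u
    proof (induction u)
      case (Cons m u)
      have "u @ v \<in> S" "(m # u) @ v \<in> S" unfolding S_def by blast+
      then have "?E ((m # u) @ v) (u @ v)" by (auto simp: adjacent_def)
      then show ?case using Cons by (rule converse_rtranclp_into_rtranclp)
    qed simp
    have "symp ?E" by (auto simp: symp_def adjacent_def)
    then have "symp ?E\<^sup>*\<^sup>*" by (rule symp_rtranclp)
    then have "?E\<^sup>*\<^sup>* (u @ v) (u' @ v)" for u u'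
      using down[of u] down[of u'] by (meson rtranclp_trans sympE)
    then have "subtree S" unfolding subtree_def S_def by auto
    then show ?thesis
      unfolding stable_subtree_def S_def using stable_vertex_label[OF st[OF v]] by auto
  qed
  ultimately have "S = \<Gamma>" by (intro max)
  then show ?thesis using that st[OF v] S_def by blast
qed

subsection \<open>Cyclically reduced words of generic vertices\<close>

definition opener :: "bool \<Rightarrow> word" where
  "opener s = (if s then [la] else [lB])"

definition closer :: "bool \<Rightarrow> word" where
  "closer s = (if s then [lb] else [lA])"

text \<open>
  A block \<open>(z, s, u)\<close> of sign \<open>s\<close> stands for \<open>a u b\<close> or \<open>B u A\<close>; the flag \<open>z\<close> marks the copies
  of the word z and its inverse.  Between blocks of equal sign no letter cancels, and
  between blocks of opposite signs exactly the closing and the opening letter cancel.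
\<close>

type_synonym block = "bool \<times> bool \<times> word"

abbreviation is_z :: "block \<Rightarrow> bool" where "is_z b \<equiv> fst b"
abbreviation sign :: "block \<Rightarrow> bool" where "sign b \<equiv> fst (snd b)"
abbreviation core :: "block \<Rightarrow> word" where "core b \<equiv> snd (snd b)"

definition block_word :: "block \<Rightarrow> word" where
  "block_word b = opener (sign b) @ core b @ closer (sign b)"

text \<open>z = a BA b ends like a positive block and its inverse B ab A like a negative one, but
  the letters in between have the opposite sign.\<close>

definition z_core :: "bool \<Rightarrow> word" where
  "z_core s = (if s then [lB, lA] else [la, lb])"

definition valid_block :: "block \<Rightarrow> bool" where
  "valid_block b \<longleftrightarrow>
     (if is_z b then core b = z_core (sign b) else set (core b) \<subseteq> letters_of_sign (sign b))"

text \<open>At a sign change the two cores become adjacent. If exactly one block is a z-block, the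
  cores have letters of equal sign and cancellation stops; otherwise it could continue.\<close>

definition compatible :: "block \<Rightarrow> block \<Rightarrow> bool" where
  "compatible b c \<longleftrightarrow> sign b = sign c \<or> is_z b \<noteq> is_z c"

definition junction :: "bool \<Rightarrow> bool \<Rightarrow> word" where
  "junction s t = (if s = t then closer s @ opener s else [])"

text \<open>The second argument is the block that follows the list.\<close>

fun trimmed :: "block list \<Rightarrow> block \<Rightarrow> word" where
  "trimmed [] e = []"
| "trimmed (b # bs) e = core b @ junction (sign b) (sign (hd (bs @ [e]))) @ trimmed bs e"

lemma trimmed_append:
  "trimmed (bs @ cs) e = trimmed bs (hd (cs @ [e])) @ trimmed cs e"
proof (induction bs)
  case (Cons b bs)
  then show ?case by (cases bs) auto
qed simp

lemma free_eq_closer_opener: "free_eq (closer s @ opener t) (junction s t)"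
proof -
  have "free_eq [lb, lB] []" "free_eq [lA, la] []"
    using free_eq_inv_right[of "[lb]"] free_eq_inv_right[of "[lA]"] by (simp_all add: word_inv_def)
  then show ?thesis by (auto simp: closer_def opener_def junction_def)
qed

text \<open>The opening letter of the following block completes the last junction. If
  \<open>e\<close> is the first block of the list, this is a conjugation by that letter, in the form
  that \<open>curve_of_conj\<close> takes.\<close>

lemma free_eq_trimmed:
  "free_eq (concat (map block_word bs) @ opener (sign e))
     (opener (sign (hd (bs @ [e]))) @ trimmed bs e)"
proof (induction bs)
  case (Cons b bs)
  let ?c = "hd (bs @ [e])"
  have "free_eq (block_word b @ concat (map block_word bs) @ opener (sign e))
      (block_word b @ opener (sign ?c) @ trimmed bs e)"
    by (rule free_eq_append[OF free_eq_refl Cons.IH])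
  also have "block_word b @ opener (sign ?c) @ trimmed bs e =
      (opener (sign b) @ core b) @ (closer (sign b) @ opener (sign ?c)) @ trimmed bs e"
    by (simp add: block_word_def)
  also have "free_eq \<dots>
      ((opener (sign b) @ core b) @ junction (sign b) (sign ?c) @ trimmed bs e)"
    by (rule free_eq_ctxt[OF free_eq_closer_opener])
  finally show ?case by simp
qed simp

lemma curve_of_trimmed:
  assumes "bs \<noteq> []"
  shows "curve_of (concat (map block_word bs)) = curve_of (trimmed bs (hd bs))"
  by (rule curve_of_conj[of _ "opener (sign (hd bs))"])
    (use free_eq_trimmed[of bs "hd bs"] assms in simp)

definition core_sign :: "block \<Rightarrow> bool" where
  "core_sign b \<longleftrightarrow> is_z b \<noteq> sign b"

lemma set_core: "valid_block b \<Longrightarrow> set (core b) \<subseteq> letters_of_sign (core_sign b)"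
  by (auto simp: valid_block_def core_sign_def z_core_def letters_of_sign_def split: if_splits)

lemma letters_of_sign_not_inv:
  "l \<in> letters_of_sign s \<Longrightarrow> l' \<in> letters_of_sign s \<Longrightarrow> l' \<noteq> letter_inv l"
  by (auto simp: letters_of_sign_def split: if_splits)

lemma reduced_letters_of_sign: "set w \<subseteq> letters_of_sign s \<Longrightarrow> reduced w"
proof (induction w)
  case (Cons l w)
  then show ?case
    using letters_of_sign_not_inv[of l s "hd w"] by (cases w) (auto simp: reduced_Cons)
qed simp

lemma hd_in_core_sign: "valid_block b \<Longrightarrow> core b \<noteq> [] \<Longrightarrow> hd (core b) \<in> letters_of_sign (core_sign b)"
  using set_core hd_in_set by blast

lemma last_in_core_sign: "valid_block b \<Longrightarrow> core b \<noteq> [] \<Longrightarrow> last (core b) \<in> letters_of_sign (core_sign b)"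
  using set_core last_in_set by blast

lemma reduced_trimmed:
  assumes "\<forall>b \<in> set bs. valid_block b" "successively compatible (bs @ [e])"
  shows "reduced (trimmed bs e)"
proof -
  \<comment> \<open>The first letter must be controlled in the induction, since an unmarked core may
    be empty and the letter may come from a later block. For z-blocks its sign is not enough: after
    an opening a, the core BA is harmless only because it starts with B.\<close>
  have "reduced (trimmed bs e) \<and> (trimmed bs e \<noteq> [] \<longrightarrow>
      hd (trimmed bs e) \<in> letters_of_sign (core_sign (hd bs)) \<and>
      (is_z (hd bs) \<longrightarrow> hd (trimmed bs e) = hd (z_core (sign (hd bs)))))"
    using assms
  proof (induction bs)
    case (Cons b bs)
    let ?c = "hd (bs @ [e])"
    let ?j = "junction (sign b) (sign ?c)"
    let ?t = "trimmed bs e"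
    have vb: "valid_block b" and cmp: "compatible b ?c"
      using Cons.prems by (auto simp: successively_Cons)
    have "\<forall>b \<in> set bs. valid_block b" "successively compatible (bs @ [e])"
      using Cons.prems by (auto simp: successively_Cons)
    note * = Cons.IH[OF this]
    have IH: "reduced ?t"
      "?t \<noteq> [] \<Longrightarrow> hd ?t \<in> letters_of_sign (core_sign (hd bs))"
      "?t \<noteq> [] \<Longrightarrow> is_z (hd bs) \<Longrightarrow> hd ?t = hd (z_core (sign (hd bs)))"
      using * by blast+
    have c: "?c = hd bs" if "?t \<noteq> []" using that by (cases bs) auto
    have rc: "reduced (core b)" using reduced_letters_of_sign[OF set_core[OF vb]] .
    have z: "is_z b \<Longrightarrow> core b = z_core (sign b)" using vb by (simp add: valid_block_def)
    have lc: "core b \<noteq> [] \<Longrightarrow> last (core b) \<in> letters_of_sign (core_sign b)"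
      and hc: "core b \<noteq> [] \<Longrightarrow> hd (core b) \<in> letters_of_sign (core_sign b)"
      using vb by (simp_all add: last_in_core_sign hd_in_core_sign)
    show ?case
    proof (cases "sign b = sign ?c")
      case True
      have j: "?j = closer (sign b) @ opener (sign b)" using True by (simp add: junction_def)
      have 1: "core b = [] \<or> hd ?j \<noteq> letter_inv (last (core b))"
        using lc z unfolding j
        by (cases "is_z b"; cases "sign b")
          (auto simp: closer_def z_core_def core_sign_def letters_of_sign_def)
      have 2: "?t = [] \<or> hd ?t \<noteq> letter_inv (last ?j)"
        using IH(2,3) c True unfolding j
        by (cases "is_z (hd bs)"; cases "sign b")
          (auto simp: opener_def z_core_def core_sign_def letters_of_sign_def)
      have 3: "?j \<noteq> []" "reduced ?j"
        unfolding j by (auto simp: closer_def opener_def reduced_Cons)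
      have "reduced (?j @ ?t)" using 2 3 IH(1) by (auto simp: reduced_append_iff)
      then have red: "reduced (core b @ ?j @ ?t)"
        using 1 3 rc by (subst reduced_append_iff) auto
      have "hd (core b @ ?j @ ?t) \<in> letters_of_sign (core_sign b)"
      proof (cases "core b = []")
        case True
        then have "\<not> is_z b" using z by (auto simp: z_core_def split: if_splits)
        with True show ?thesis
          unfolding j by (auto simp: closer_def core_sign_def letters_of_sign_def)
      qed (use hc in simp)
      moreover have "is_z b \<longrightarrow> hd (core b @ ?j @ ?t) = hd (z_core (sign b))"
        using z by (auto simp: z_core_def)
      ultimately show ?thesis using red by simp
    next
      case False
      then have j: "?j = []" by (simp add: junction_def)
      have "core_sign ?c = core_sign b"
        using False cmp by (auto simp: core_sign_def compatible_def)
      then have ht: "?t \<noteq> [] \<Longrightarrow> hd ?t \<in> letters_of_sign (core_sign b)"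
        using IH(2) c by auto
      have "reduced (core b @ ?t)"
        using rc IH(1) lc ht letters_of_sign_not_inv unfolding reduced_append_iff by blast
      moreover have "core b @ ?t \<noteq> [] \<longrightarrow> hd (core b @ ?t) \<in> letters_of_sign (core_sign b)"
        using hc ht by (cases "core b = []") auto
      moreover have "is_z b \<longrightarrow> hd (core b @ ?t) = hd (z_core (sign b))"
        using z by (auto simp: z_core_def)
      ultimately show ?thesis using j by simp
    qed
  qed simp
  then show ?thesis by blast
qed

text \<open>The square of a cyclically trimmed word is the trimmed word of the doubled list, which
  reduces the cyclic case to the linear one.\<close>

lemma cyclically_reduced_trimmed:
  assumes "bs \<noteq> []" "\<forall>b \<in> set bs. valid_block b" "successively compatible (bs @ [hd bs])"
  shows "reduced (trimmed bs (hd bs) @ trimmed bs (hd bs))"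
proof -
  have "successively compatible ((bs @ bs) @ [hd bs])"
    using assms(1,3) by (auto simp: successively_append_iff)
  then have "reduced (trimmed (bs @ bs) (hd bs))"
    using assms(2) by (intro reduced_trimmed) auto
  then show ?thesis using assms(1) by (simp add: trimmed_append)
qed

text \<open>
  The surplus of letters a, A (equally, of letters b, B) in a trimmed word over the blocks
  that are not marked.
\<close>

fun excess :: "(bool \<times> bool) list \<Rightarrow> bool \<times> bool \<Rightarrow> int" where
  "excess [] e = 0"
| "excess (b # bs) e =
     (if fst b then 1 else -1) + (if snd b = snd (hd (bs @ [e])) then 1 else 0) + excess bs e"

definition pattern :: "block \<Rightarrow> bool \<times> bool" where
  "pattern b = (is_z b, sign b)"

lemma pattern_sel [simp]: "fst (pattern b) = is_z b" "snd (pattern b) = sign b"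
  by (simp_all add: pattern_def)

definition acount :: "word \<Rightarrow> nat" where
  "acount w = length (filter (\<lambda>l. l \<in> {la, lA}) w)"

definition bcount :: "word \<Rightarrow> nat" where
  "bcount w = length (filter (\<lambda>l. l \<in> {lb, lB}) w)"

lemma count_simps [simp]:
  "acount [] = 0" "bcount [] = 0"
  "acount (l # w) = (if l \<in> {la, lA} then 1 else 0) + acount w"
  "bcount (l # w) = (if l \<in> {lb, lB} then 1 else 0) + bcount w"
  "acount (v @ w) = acount v + acount w"
  "bcount (v @ w) = bcount v + bcount w"
  by (simp_all add: acount_def bcount_def)

lemma length_eq_counts: "length w = acount w + bcount w"
proof (induction w)
  case (Cons l w)
  then show ?case by (cases l) auto
qed simp

text \<open>An unmarked block loses its two end letters, a z-core adds two letters and so does a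
  surviving junction; each time one is an a or A and the other a b or B. This is why both counts
  share one excess.\<close>

lemma counts_trimmed:
  assumes "\<forall>b \<in> set bs. valid_block b"
  defines "ws \<equiv> concat (map block_word (filter (\<lambda>b. \<not> is_z b) bs))"
  shows "int (acount (trimmed bs e)) = excess (map pattern bs) (pattern e) + int (acount ws)"
    and "int (bcount (trimmed bs e)) = excess (map pattern bs) (pattern e) + int (bcount ws)"
proof -
  have "int (acount (trimmed bs e)) = excess (map pattern bs) (pattern e) +
        int (acount (concat (map block_word (filter (\<lambda>b. \<not> is_z b) bs)))) \<and>
      int (bcount (trimmed bs e)) = excess (map pattern bs) (pattern e) +
        int (bcount (concat (map block_word (filter (\<lambda>b. \<not> is_z b) bs))))"
    using assms(1)
  proof (induction bs)
    case (Cons b bs)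
    have "snd (hd (map pattern bs @ [pattern e])) = sign (hd (bs @ [e]))"
      by (cases bs) auto
    with Cons show ?case
      by (auto simp: junction_def block_word_def opener_def closer_def
          valid_block_def z_core_def)
  qed simp
  then show "int (acount (trimmed bs e)) = excess (map pattern bs) (pattern e) + int (acount ws)"
    and "int (bcount (trimmed bs e)) = excess (map pattern bs) (pattern e) + int (bcount ws)"
    unfolding ws_def by blast+
qed

text \<open>Modulo 2 a block contributes 1 exactly when the sign changes after it, and around a
  cycle the number of sign changes is even.\<close>

lemma even_excess: "even (excess bs e) \<longleftrightarrow> snd (hd (bs @ [e])) = snd e"
  by (induction bs) auto

text \<open>A sign change after a block not marked is paid for by the following marked block.\<close>

lemma excess_ge:
  assumes "successively (\<lambda>b c. snd b = snd c \<or> fst b \<noteq> fst c) (bs @ [e])"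
  shows "excess bs e \<ge> of_bool (fst (hd (bs @ [e]))) - of_bool (fst e)"
  using assms
proof (induction bs)
  case (Cons b bs)
  then have *: "snd b = snd (hd (bs @ [e])) \<or> fst b \<noteq> fst (hd (bs @ [e]))"
    and "excess bs e \<ge> of_bool (fst (hd (bs @ [e]))) - of_bool (fst e)"
    by (auto simp: successively_Cons)
  then show ?case by (auto simp: of_bool_def split: if_splits)
qed simp

section \<open>Letter counts and end letters of twisted words\<close>

fun twist_vec :: "twist \<Rightarrow> nat \<times> nat \<Rightarrow> nat \<times> nat" where
  "twist_vec TL (p, q) = (p + q, q)"
| "twist_vec TR (p, q) = (p, p + q)"

definition twists_vec :: "vertex \<Rightarrow> nat \<times> nat \<Rightarrow> nat \<times> nat" where
  "twists_vec u = foldr twist_vec u"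

lemma twists_vec_simps [simp]:
  "twists_vec [] x = x" "twists_vec (m # u) x = twist_vec m (twists_vec u x)"
  "twists_vec (u @ v) x = twists_vec u (twists_vec v x)"
  by (simp_all add: twists_vec_def)

definition counts :: "word \<Rightarrow> nat \<times> nat" where
  "counts w = (acount w, bcount w)"

lemma counts_twists: "counts (twists u w) = twists_vec u (counts w)"
proof -
  have "counts (twist_word m v) = twist_vec m (counts v)" for m v
  proof (induction v)
    case (Cons l v)
    then show ?case
      by (cases m; cases l) (auto simp: twist_word_Cons counts_def)
  qed (cases m; simp add: counts_def)
  then show ?thesis by (induction u) auto
qed

definition word_sign :: "word \<Rightarrow> bool" where
  "word_sign w \<longleftrightarrow> hd w \<in> {la, lb}"

lemma word_sign_eq: "w \<noteq> [] \<Longrightarrow> set w \<subseteq> letters_of_sign s \<Longrightarrow> word_sign w = s"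
  by (cases w) (auto simp: word_sign_def letters_of_sign_def split: if_splits)

lemma hd_twist_word:
  assumes "v \<noteq> []" "set v \<subseteq> letters_of_sign s"
  shows "hd (twist_word m v) = (if (m = TL) = s then (if s then la else lB) else hd v)"
  using assms
  by (cases v; cases m; cases "hd v")
    (auto simp: letters_of_sign_def twist_word_Cons split: if_splits)

lemma last_twist_word:
  assumes "v \<noteq> []" "set v \<subseteq> letters_of_sign s"
  shows "last (twist_word m v) = (if (m = TR) = s then (if s then lb else lA) else last v)"
  using assms
  by (cases v rule: rev_cases; cases m; cases "last v")
    (auto simp: letters_of_sign_def twist_word_Cons split: if_splits)

text \<open>L makes every positive word start with a, and R preserves this because a goes to ab; for
  negative words R produces the initial B and L preserves it.\<close>

lemma hd_twists:
  assumes "w \<noteq> []" "set w \<subseteq> letters_of_sign s" "(if s then TL else TR) \<in> set u"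
  shows "hd (twists u w) = (if s then la else lB)"
  using assms(3)
proof (induction u)
  case (Cons m u)
  have "hd (twists (m # u) w) =
      (if (m = TL) = s then (if s then la else lB) else hd (twists u w))"
    using assms hd_twist_word[OF _ set_twists[OF assms(2)], of u m] by simp
  with Cons show ?case by (cases m) (auto split: if_splits)
qed simp

lemma last_twists:
  assumes "w \<noteq> []" "set w \<subseteq> letters_of_sign s" "(if s then TR else TL) \<in> set u"
  shows "last (twists u w) = (if s then lb else lA)"
  using assms(3)
proof (induction u)
  case (Cons m u)
  have "last (twists (m # u) w) =
      (if (m = TR) = s then (if s then lb else lA) else last (twists u w))"
    using assms last_twist_word[OF _ set_twists[OF assms(2)], of u m] by simp
  with Cons show ?case by (cases m) (auto split: if_splits)
qed simp

section \<open>Blocks of a twisted stable word\<close>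

definition inner :: "word \<Rightarrow> word" where
  "inner w = butlast (tl w)"

lemma generic_twists_eq:
  assumes "w \<noteq> []" "set w \<subseteq> letters_of_sign s" "TL \<in> set u" "TR \<in> set u"
  shows "opener s @ inner (twists u w) @ closer s = twists u w"
proof -
  let ?v = "twists u w"
  have hd: "hd ?v = (if s then la else lB)" and last: "last ?v = (if s then lb else lA)"
    using hd_twists[OF assms(1,2)] last_twists[OF assms(1,2)] assms(3,4) by auto
  have "tl ?v \<noteq> []"
  proof
    assume "tl ?v = []"
    then have "hd ?v = last ?v" using assms(1) by (cases ?v) auto
    with hd last show False by (auto split: if_splits)
  qed
  then have "?v = [hd ?v] @ inner ?v @ [last ?v]"
    unfolding inner_def
    by (metis append_Cons append_Nil append_butlast_last_id hd_Cons_tl last_tl list.sel(2))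
  then show ?thesis using hd last by (auto simp: opener_def closer_def)
qed

text \<open>The last block spells the piece only if the piece has the form a u b or B u A. Before
  twisting, \<open>inner\<close> may drop other letters; of the untwisted blocks only marks and
  signs are used.\<close>

definition piece_blocks :: "int \<times> word \<Rightarrow> block list" where
  "piece_blocks p = replicate (nat \<bar>fst p\<bar>) (True, fst p > 0, z_core (fst p > 0)) @
     [(False, word_sign (snd p), inner (snd p))]"

definition blocks :: "(int \<times> word) list \<Rightarrow> block list" where
  "blocks ps = concat (map piece_blocks ps)"

lemma blocks_simps [simp]:
  "blocks [] = []" "blocks (p # ps) = piece_blocks p @ blocks ps"
  by (simp_all add: blocks_def)

lemma block_word_z: "block_word (True, s, z_core s) = (if s then z_word else word_inv z_word)"
  by (simp add: block_word_def z_core_def opener_def closer_def z_word_def word_inv_def)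

lemma concat_block_words:
  assumes "\<forall>p \<in> set ps. block_word (False, word_sign (snd p), inner (snd p)) = snd p"
  shows "concat (map block_word (blocks ps)) = stable_word ps"
proof -
  have "concat (map block_word (piece_blocks (e, w))) = word_pow z_word e @ w"
    if "block_word (False, word_sign w, inner w) = w" for e w
    using that by (auto simp: piece_blocks_def map_replicate block_word_z word_pow_def)
  with assms show ?thesis by (induction ps) (auto simp: stable_word_def)
qed

lemma concat_unmarked_block_words:
  assumes "\<forall>p \<in> set ps. block_word (False, word_sign (snd p), inner (snd p)) = snd p"
  shows "concat (map block_word (filter (\<lambda>b. \<not> is_z b) (blocks ps))) = concat (map snd ps)"
  using assms by (induction ps) (auto simp: piece_blocks_def)

lemma valid_blocks:
  assumes "\<forall>p \<in> set ps. snd p \<noteq> [] \<and> monotone_word (snd p)"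
  shows "\<forall>b \<in> set (blocks ps). valid_block b"
proof -
  have "set (inner w) \<subseteq> letters_of_sign (word_sign w)" if w: "w \<noteq> []" "monotone_word w" for w
  proof -
    obtain s where s: "set w \<subseteq> letters_of_sign s"
      using w monotone_word_iff by blast
    have "set (inner w) \<subseteq> set w"
      using w(1) unfolding inner_def by (meson in_set_butlastD list.set_sel(2) subsetI)
    with s show ?thesis using word_sign_eq[OF w(1) s] by blast
  qed
  with assms show ?thesis
    by (auto simp: blocks_def piece_blocks_def valid_block_def split: if_splits)
qed

text \<open>Non-zero exponents keep unmarked blocks apart, and adjacent z-blocks belong to one power
  and have equal sign. The closing block is a z-block because every piece then starts with
  one.\<close>

lemma compatible_blocks:
  assumes "\<forall>p \<in> set ps. fst p \<noteq> 0" "is_z e"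
  shows "successively compatible (blocks ps @ [e])"
proof -
  have rep: "successively compatible (replicate n b)" for n b
    by (induction n) (auto simp: successively_Cons compatible_def hd_replicate)
  have "successively compatible (blocks ps @ [e]) \<and> is_z (hd (blocks ps @ [e]))"
    using assms(1)
  proof (induction ps)
    case (Cons p ps)
    obtain n where n: "nat \<bar>fst p\<bar> = Suc n"
      using Cons.prems by (cases "nat \<bar>fst p\<bar>") auto
    show ?case
      using Cons rep[of "Suc n"] unfolding blocks_simps piece_blocks_def n
      by (auto simp: successively_append_iff successively_Cons compatible_def
          simp del: replicate_Suc simp flip: replicate_Suc)
  qed (use assms(2) in simp)
  then show ?thesis ..
qed

text \<open>Both letter counts are recorded and not only their sum, because they are what
  distinguishes the curves at different vertices.\<close>

lemma generic_representative:
  assumes "admissible ps"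
  obtains K :: nat where "\<And>u. TL \<in> set u \<Longrightarrow> TR \<in> set u \<Longrightarrow>
    \<exists>w. reduced (w @ w) \<and> curve_of w = vertex_label (curve_of (stable_word ps)) u \<and>
      counts w = (2 * K + fst (twists_vec u (counts (concat (map snd ps)))),
                  2 * K + snd (twists_vec u (counts (concat (map snd ps)))))"
proof (cases "\<forall>p \<in> set ps. fst p \<noteq> 0")
  case False
  \<comment> \<open>A zero exponent is allowed only for a single piece. The curve is then a monotone
    word, in which nothing cancels, and K = 0.\<close>
  with assms obtain w where ps: "ps = [(0, w)]"
    unfolding admissible_def by (cases ps) (auto simp: Suc_le_eq)
  with assms obtain s where s: "set w \<subseteq> letters_of_sign s"
    unfolding admissible_def monotone_word_iff by auto
  have "stable_word ps = w" by (simp add: ps stable_word_def word_pow_def)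
  moreover have "reduced (twists u w @ twists u w)" for u
    using set_twists[OF s, of u] by (intro reduced_letters_of_sign) auto
  ultimately show ?thesis
    by (intro that[of 0] exI[of _ "twists _ w"])
      (simp add: vertex_label_curve_of counts_twists[symmetric] ps)
next
  case True
  define tw where "tw u = map (map_prod id (twists u)) ps" for u
  define pat where "pat = map pattern (blocks ps)"
  have ps: "ps \<noteq> []" using assms by (simp add: admissible_def)
  have mono: "\<exists>s. set (snd p) \<subseteq> letters_of_sign s" "snd p \<noteq> []" if "p \<in> set ps" for p
    using assms that unfolding admissible_def monotone_word_iff by (auto simp: split_beta)
  have pat_ne: "pat \<noteq> []" using ps by (cases ps) (auto simp: pat_def piece_blocks_def)
  \<comment> \<open>The marks and signs do not depend on \<open>u\<close>, and the excess depends on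
    nothing else; hence one K for all \<open>u\<close>.\<close>
  have pattern_tw: "map pattern (blocks (tw u)) = pat" for u
  proof -
    have "map pattern (piece_blocks (map_prod id (twists u) p)) = map pattern (piece_blocks p)"
      if p: "p \<in> set ps" for p
    proof -
      obtain s where s: "set (snd p) \<subseteq> letters_of_sign s" using mono[OF p] by blast
      have "word_sign (twists u (snd p)) = s" "word_sign (snd p) = s"
        using word_sign_eq[OF _ s] word_sign_eq[OF _ set_twists[OF s]] mono(2)[OF p] by auto
      then show ?thesis by (simp add: piece_blocks_def pattern_def)
    qed
    then show ?thesis
      unfolding pat_def tw_def blocks_def map_concat by (simp cong: map_cong)
  qed
  have hd_pat: "fst (hd pat)" "hd (pat @ [hd pat]) = hd pat"
    using ps True pat_ne by (cases ps; auto simp: pat_def piece_blocks_def pattern_def hd_append)+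
  have "hd (blocks ps) \<in> set (blocks ps)" "is_z (hd (blocks ps))"
    using hd_pat(1) pat_ne by (auto simp: pat_def hd_map)
  from compatible_blocks[OF True this(2)]
  have "successively (\<lambda>b c. snd b = snd c \<or> fst b \<noteq> fst c) (pat @ [hd pat])"
    using pat_ne unfolding pat_def compatible_def
    by (simp add: hd_map successively_map flip: list.map(2) map_append)
       (simp add: successively_append_iff successively_map hd_map last_map)
  \<comment> \<open>The block that follows the list is its first block, so the two boundary terms in
    \<open>excess_ge\<close> cancel. Evenness then gives 2 K in each letter count, hence 4 K in the
    length.\<close>
  then have "excess pat (hd pat) \<ge> 0" using excess_ge hd_pat by fastforce
  moreover have "even (excess pat (hd pat))" using even_excess hd_pat by simp
  ultimately have "excess pat (hd pat) = 2 * int (nat (excess pat (hd pat) div 2))"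
    by simp
  then obtain K :: nat where K: "excess pat (hd pat) = 2 * int K" by blast
  show ?thesis
  proof (rule that[of K], goal_cases)
    case (1 u)
    let ?bs = "blocks (tw u)"
    let ?w = "trimmed ?bs (hd ?bs)"
    have adm: "admissible (tw u)" unfolding tw_def by (rule admissible_twists[OF assms])
    have mono_tw: "\<forall>p \<in> set (tw u). snd p \<noteq> [] \<and> monotone_word (snd p)"
      using adm by (auto simp: admissible_def)
    have bw: "\<forall>p \<in> set (tw u). block_word (False, word_sign (snd p), inner (snd p)) = snd p"
    proof
      fix p assume "p \<in> set (tw u)"
      then obtain w s where w: "snd p = twists u w" "w \<noteq> []" "set w \<subseteq> letters_of_sign s"
        using mono unfolding tw_def by fastforce
      have "word_sign (twists u w) = s"
        using w set_twists word_sign_eq by (metis twists_eq_Nil_iff)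
      then show "block_word (False, word_sign (snd p), inner (snd p)) = snd p"
        using generic_twists_eq[OF w(2,3) 1] w(1) by (simp add: block_word_def)
    qed
    have ne: "?bs \<noteq> []" using pattern_tw[of u] pat_ne by auto
    have hd_bs: "pattern (hd ?bs) = hd pat" using ne pattern_tw[of u] by (metis hd_map)
    have "\<forall>p \<in> set (tw u). fst p \<noteq> 0" using True by (auto simp: tw_def)
    moreover have "is_z (hd ?bs)" using hd_bs hd_pat(1) by (metis pattern_sel(1))
    ultimately have "reduced (?w @ ?w)"
      by (intro cyclically_reduced_trimmed ne valid_blocks mono_tw compatible_blocks)
    moreover have "curve_of ?w = vertex_label (curve_of (stable_word ps)) u"
      using curve_of_trimmed[OF ne] concat_block_words[OF bw]
        curve_of_free_eq[OF free_eq_twists_stable_word[of u ps]]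
      by (simp add: vertex_label_curve_of tw_def)
    moreover have "concat (map snd (tw u)) = twists u (concat (map snd ps))"
      unfolding tw_def by (induction ps) auto
    then have "counts (concat (map block_word (filter (\<lambda>b. \<not> is_z b) ?bs))) =
        twists_vec u (counts (concat (map snd ps)))"
      using concat_unmarked_block_words[OF bw] by (simp add: counts_twists)
    then have "counts ?w = (2 * K + fst (twists_vec u (counts (concat (map snd ps)))),
                  2 * K + snd (twists_vec u (counts (concat (map snd ps)))))"
      using counts_trimmed[OF valid_blocks[OF mono_tw], of "hd ?bs"] K
      unfolding pattern_tw hd_bs counts_def prod_eq_iff fst_conv snd_conv by linarith
    ultimately show ?case by blast
  qed
qed

subsection \<open>Lengths along the powers of one twist\<close>

text \<open>
  The twist \<open>m\<close> fixes one generator and multiplies the other one by it, so a curve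
  is written as a cyclic product of moved letters separated by powers of the fixed letter: each
  iteration changes these exponents by constants.
\<close>

definition fixed_letter :: "twist \<Rightarrow> letter" where
  "fixed_letter m = (case m of TL \<Rightarrow> la | TR \<Rightarrow> lb)"

definition moved_letter :: "twist \<Rightarrow> bool \<Rightarrow> letter" where
  "moved_letter m s = (case m of TL \<Rightarrow> if s then lb else lB | TR \<Rightarrow> if s then la else lA)"

definition letter_pow :: "letter \<Rightarrow> int \<Rightarrow> word" where
  "letter_pow l n = (if n \<ge> 0 then replicate (nat n) l else replicate (nat (- n)) (letter_inv l))"

lemma letter_pow_0 [simp]: "letter_pow l 0 = []"
  by (simp add: letter_pow_def)

lemma length_letter_pow [simp]: "length (letter_pow l n) = nat \<bar>n\<bar>"
  by (simp add: letter_pow_def)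

lemma free_eq_cancel_pair: "free_eq (letter_inv l # l # w) w" "free_eq (l # letter_inv l # w) w"
  using free_eq_ctxt[OF free_eq_inv_left[of "[l]"], of "[]" w]
    free_eq_ctxt[OF free_eq_inv_right[of "[l]"], of "[]" w]
  by (simp_all add: word_inv_def)

lemma free_eq_Cons_letter_pow:
  "free_eq (l # letter_pow l n) (letter_pow l (n + 1))"
  "free_eq (letter_inv l # letter_pow l n) (letter_pow l (n - 1))"
proof -
  have 1: "letter_pow l (n + 1) = l # letter_pow l n" if "n \<ge> 0" for n
    using that by (simp add: letter_pow_def nat_add_distrib)
  have 2: "letter_pow l (n - 1) = letter_inv l # letter_pow l n" if "n \<le> 0" for n
  proof -
    have "nat (1 - n) = Suc (nat (- n))" using that by simp
    then show ?thesis using that by (simp add: letter_pow_def)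
  qed
  show "free_eq (l # letter_pow l n) (letter_pow l (n + 1))"
    using 1[of n] 2[of "n + 1"] free_eq_cancel_pair(2) by (cases "n \<ge> 0") auto
  show "free_eq (letter_inv l # letter_pow l n) (letter_pow l (n - 1))"
    using 2[of n] 1[of "n - 1"] free_eq_cancel_pair(1) by (cases "n \<le> 0") auto
qed

lemma free_eq_letter_pow_add: "free_eq (letter_pow l i @ letter_pow l j) (letter_pow l (i + j))"
proof -
  have 1: "free_eq (replicate n l @ letter_pow l j) (letter_pow l (int n + j))" for n
  proof (induction n)
    case (Suc n)
    have "free_eq ([l] @ replicate n l @ letter_pow l j) ([l] @ letter_pow l (int n + j))"
      by (rule free_eq_append[OF free_eq_refl Suc])
    also have "free_eq \<dots> (letter_pow l (int (Suc n) + j))"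
      using free_eq_Cons_letter_pow(1)[of l "int n + j"] by (simp add: algebra_simps)
    finally show ?case by simp
  qed simp
  have 2: "free_eq (replicate n (letter_inv l) @ letter_pow l j) (letter_pow l (j - int n))" for n
  proof (induction n)
    case (Suc n)
    have "free_eq ([letter_inv l] @ replicate n (letter_inv l) @ letter_pow l j)
        ([letter_inv l] @ letter_pow l (j - int n))"
      by (rule free_eq_append[OF free_eq_refl Suc])
    also have "free_eq \<dots> (letter_pow l (j - int (Suc n)))"
      using free_eq_Cons_letter_pow(2)[of l "j - int n"] by (simp add: algebra_simps)
    finally show ?case by simp
  qed simp
  show ?thesis
    using 1[of "nat i"] 2[of "nat (- i)"] unfolding letter_pow_def[of l i]
    by (cases "i \<ge> 0") (auto simp: algebra_simps)
qed

definition syllables :: "twist \<Rightarrow> (bool \<times> int) list \<Rightarrow> word" where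
  "syllables m ps = concat (map (\<lambda>(s, n). moved_letter m s # letter_pow (fixed_letter m) n) ps)"

lemma syllables_simps [simp]:
  "syllables m [] = []"
  "syllables m ((s, n) # ps) =
     moved_letter m s # letter_pow (fixed_letter m) n @ syllables m ps"
  "syllables m (ps @ qs) = syllables m ps @ syllables m qs"
  by (simp_all add: syllables_def)

lemma letter_inv_moved [simp]: "letter_inv (moved_letter m s) = moved_letter m (\<not> s)"
  by (cases m; cases s) (auto simp: moved_letter_def)

lemma moved_letter_eq_iff [simp]: "moved_letter m s = moved_letter m t \<longleftrightarrow> s = t"
  by (cases m; cases s; cases t) (auto simp: moved_letter_def)

lemma moved_neq_fixed:
  "moved_letter m s \<noteq> fixed_letter m" "moved_letter m s \<noteq> letter_inv (fixed_letter m)"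
  by (cases m; cases s; simp add: moved_letter_def fixed_letter_def)+

lemma free_eq_letter_pow_syllables:
  "\<exists>n ps. free_eq w (letter_pow (fixed_letter m) n @ syllables m ps)"
proof (induction w)
  case Nil
  show ?case by (intro exI[of _ 0] exI[of _ "[]"]) simp
next
  case (Cons l w)
  let ?x = "fixed_letter m"
  obtain n ps where w: "free_eq w (letter_pow ?x n @ syllables m ps)"
    using Cons by blast
  have lw: "free_eq (l # w) (l # letter_pow ?x n @ syllables m ps)"
    using free_eq_append[OF free_eq_refl[of "[l]"] w] by simp
  have "l = ?x \<or> l = letter_inv ?x \<or> (\<exists>s. l = moved_letter m s)"
    by (cases m; cases l) (auto simp: fixed_letter_def moved_letter_def ex_bool_eq)
  then consider "l = ?x" | "l = letter_inv ?x" | s where "l = moved_letter m s" by blast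
  then show ?case
  proof cases
    case 1
    have "free_eq (l # letter_pow ?x n @ syllables m ps) (letter_pow ?x (n + 1) @ syllables m ps)"
      using free_eq_append[OF free_eq_Cons_letter_pow(1)[of l n] free_eq_refl] 1 by simp
    with lw show ?thesis using free_eq_trans by blast
  next
    case 2
    have "free_eq (l # letter_pow ?x n @ syllables m ps) (letter_pow ?x (n - 1) @ syllables m ps)"
      using free_eq_append[OF free_eq_Cons_letter_pow(2)[of ?x n] free_eq_refl] 2 by simp
    with lw show ?thesis using free_eq_trans by blast
  next
    case (3 s)
    with lw have "free_eq (l # w) (letter_pow ?x 0 @ syllables m ((s, n) # ps))" by simp
    then show ?thesis by blast
  qed
qed

section \<open>Reduced syllable words and their shears\<close>

definition spaced :: "bool \<times> int \<Rightarrow> bool \<times> int \<Rightarrow> bool" where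
  "spaced p q \<longleftrightarrow> (snd p = 0 \<longrightarrow> fst p = fst q)"

lemma reduced_letter_pow: "reduced (letter_pow l n)"
proof -
  have "reduced (replicate k x)" for k x
    by (induction k) (auto simp: reduced_Cons hd_replicate)
  then show ?thesis by (simp add: letter_pow_def)
qed

lemma last_letter_pow: "n \<noteq> 0 \<Longrightarrow> last (letter_pow l n) \<in> {l, letter_inv l}"
  and hd_letter_pow: "n \<noteq> 0 \<Longrightarrow> hd (letter_pow l n) \<in> {l, letter_inv l}"
  by (auto simp: letter_pow_def last_replicate hd_replicate)

lemma letter_pow_eq_Nil_iff [simp]: "letter_pow l n = [] \<longleftrightarrow> n = 0"
  by (simp add: letter_pow_def)

lemma hd_syllables: "ps \<noteq> [] \<Longrightarrow> hd (syllables m ps) = moved_letter m (fst (hd ps))"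
  by (cases ps) auto

lemma reduced_syllables:
  assumes "successively spaced ps"
  shows "reduced (syllables m ps)"
  using assms
proof (induction ps)
  case (Cons p ps)
  obtain s n where p: "p = (s, n)" by fastforce
  let ?x = "fixed_letter m" and ?y = "moved_letter m s"
  have red: "reduced (syllables m ps)" using Cons by (cases ps) auto
  have ne: "moved_letter m t \<noteq> ?x" "moved_letter m t \<noteq> letter_inv ?x"
    "?x \<noteq> moved_letter m t" "letter_inv ?x \<noteq> moved_letter m t" for t
    using moved_neq_fixed[of m t] by metis+
  show ?case
  proof (cases "n = 0")
    case True
    then have "ps = [] \<or> fst (hd ps) = s"
      using Cons.prems by (cases ps) (auto simp: p spaced_def)
    then show ?thesis
      using True red hd_syllables[of ps m] by (cases "ps = []") (auto simp: p reduced_Cons)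
  next
    case False
    have "hd (letter_pow ?x n) \<noteq> letter_inv ?y"
      using hd_letter_pow[OF False, of ?x] ne by auto
    moreover have "syllables m ps = [] \<or> hd (syllables m ps) \<noteq> letter_inv (last (letter_pow ?x n))"
      using last_letter_pow[OF False, of ?x] ne hd_syllables[of ps m] by (cases ps) auto
    ultimately show ?thesis
      using False red reduced_letter_pow[of ?x n]
      by (simp add: p reduced_Cons reduced_append_iff)
  qed
qed simp

text \<open>Exponents of the fixed letter that one twist puts before and after a moved letter: L
  sends b to ab and B to BA, R sends a to ab and A to BA.\<close>

definition shift_before :: "twist \<Rightarrow> bool \<Rightarrow> int" where
  "shift_before m s = (case m of TL \<Rightarrow> if s then 1 else 0 | TR \<Rightarrow> if s then 0 else -1)"

definition shift_after :: "twist \<Rightarrow> bool \<Rightarrow> int" where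
  "shift_after m s = (case m of TL \<Rightarrow> if s then 0 else -1 | TR \<Rightarrow> if s then 1 else 0)"

definition shift :: "bool \<Rightarrow> bool \<Rightarrow> int" where
  "shift s t = (if s = t then if s then 1 else -1 else 0)"

text \<open>A gap collects what is put after the moved letter on its left and before the one on its
  right; for opposite signs these contributions cancel or are both zero.\<close>

lemma shift_eq: "shift_after m s + shift_before m t = shift s t"
  by (cases m; cases s; cases t) (auto simp: shift_after_def shift_before_def shift_def)

lemma twist_letter_pow: "twist_word m (letter_pow (fixed_letter m) n) = letter_pow (fixed_letter m) n"
proof -
  have "twist_word m (replicate k x) = replicate k x" if "twist_letter m x = [x]" for k x
    by (induction k) (auto simp: twist_word_Cons that)
  then show ?thesis by (cases m) (auto simp: letter_pow_def fixed_letter_def)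
qed

lemma twists_letter_pow:
  "twists (replicate k m) (letter_pow (fixed_letter m) n) = letter_pow (fixed_letter m) n"
  by (induction k) (auto simp: twist_letter_pow)

lemma twists_moved_letter:
  "free_eq (twists (replicate k m) [moved_letter m s])
     (letter_pow (fixed_letter m) (int k * shift_before m s) @ [moved_letter m s] @
      letter_pow (fixed_letter m) (int k * shift_after m s))"
proof (induction k)
  case (Suc k)
  let ?x = "letter_pow (fixed_letter m)"
  let ?p = "shift_before m s" and ?q = "shift_after m s" and ?y = "[moved_letter m s]"
  have step: "twist_word m ?y = ?x ?p @ ?y @ ?x ?q"
    by (cases m; cases s)
      (auto simp: twist_word_Cons moved_letter_def fixed_letter_def shift_before_def
        shift_after_def letter_pow_def)
  have "free_eq (twists (replicate (Suc k) m) ?y) (twist_word m (?x (int k * ?p) @ ?y @ ?x (int k * ?q)))"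
    using twist_word_free_eq[OF Suc] by simp
  also have "\<dots> = (?x (int k * ?p) @ ?x ?p) @ ?y @ (?x ?q @ ?x (int k * ?q))"
    using twist_word_append[of m ?y "?x (int k * ?q)"] by (simp add: twist_letter_pow step)
  also have "free_eq \<dots> (?x (int k * ?p + ?p) @ ?y @ ?x (?q + int k * ?q))"
    by (intro free_eq_append free_eq_letter_pow_add free_eq_refl)
  finally show ?case by (simp add: algebra_simps)
qed simp

text \<open>The last argument is the sign of the letter that follows the list.\<close>

fun sheared :: "int \<Rightarrow> (bool \<times> int) list \<Rightarrow> bool \<Rightarrow> (bool \<times> int) list" where
  "sheared k [] e = []"
| "sheared k ((s, n) # ps) e =
     (s, n + k * shift s (hd (map fst ps @ [e]))) # sheared k ps e"

text \<open>The power carried on the left closes the last gap, since part of it comes from the moved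
  letter that follows. If \<open>e\<close> is the sign of the first moved letter, this is a
  conjugation, as in \<open>free_eq_trimmed\<close>.\<close>

lemma free_eq_twists_syllables:
  "free_eq (twists (replicate k m) (syllables m ps) @
       letter_pow (fixed_letter m) (int k * shift_before m e))
     (letter_pow (fixed_letter m) (int k * shift_before m (hd (map fst ps @ [e]))) @
       syllables m (sheared (int k) ps e))"
proof (induction ps)
  case (Cons p ps)
  obtain s n where p: "p = (s, n)" by fastforce
  let ?x = "letter_pow (fixed_letter m)"
  let ?t = "hd (map fst ps @ [e])" and ?k = "int k"
  let ?p = "?x (?k * shift_before m s) @ [moved_letter m s]"
  let ?q = "syllables m (sheared (int k) ps e)"
  have "twists (replicate k m) (syllables m (p # ps)) @ ?x (?k * shift_before m e) =
      twists (replicate k m) [moved_letter m s] @ ?x n @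
      (twists (replicate k m) (syllables m ps) @ ?x (?k * shift_before m e))"
    using twists_append[of "replicate k m" "[moved_letter m s]" "?x n @ syllables m ps"]
    by (simp add: p twists_letter_pow)
  also have "free_eq \<dots> ((?p @ ?x (?k * shift_after m s)) @ ?x n @
      ?x (?k * shift_before m ?t) @ ?q)"
    using free_eq_append[OF twists_moved_letter free_eq_append[OF free_eq_refl Cons.IH]] by simp
  also have "\<dots> = ?p @ (?x (?k * shift_after m s) @ ?x n) @ (?x (?k * shift_before m ?t) @ ?q)"
    by simp
  also have "free_eq \<dots> (?p @ ?x (?k * shift_after m s + n) @ (?x (?k * shift_before m ?t) @ ?q))"
    by (rule free_eq_ctxt[OF free_eq_letter_pow_add])
  also have "\<dots> = ?p @ (?x (?k * shift_after m s + n) @ ?x (?k * shift_before m ?t)) @ ?q"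
    by simp
  also have "free_eq \<dots> (?p @ ?x ((?k * shift_after m s + n) + ?k * shift_before m ?t) @ ?q)"
    by (rule free_eq_ctxt[OF free_eq_letter_pow_add])
  also have "(?k * shift_after m s + n) + ?k * shift_before m ?t = n + ?k * shift s ?t"
    by (simp add: shift_eq[of m, symmetric] algebra_simps)
  finally show ?case by (simp add: p)
qed simp

lemma curve_of_twists_syllables:
  assumes "ps \<noteq> []"
  shows "curve_of (twists (replicate k m) (syllables m ps)) =
    curve_of (syllables m (sheared (int k) ps (fst (hd ps))))"
  using free_eq_twists_syllables[of k m ps "fst (hd ps)"] assms
  by (intro curve_of_conj) (simp add: hd_append hd_map)

text \<open>Only gaps between opposite signs need a non-zero exponent, and exactly these are left
  unchanged by the shear; so the word stays reduced for all powers of the twist.\<close>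

lemma spaced_sheared:
  assumes "successively spaced (ps @ [(e, n)])"
  shows "successively spaced (sheared k ps e @ [(e, n')])"
  using assms
proof (induction ps)
  case (Cons p ps)
  obtain s i where p: "p = (s, i)" by fastforce
  have IH: "successively spaced (sheared k ps e @ [(e, n')])"
    using Cons by (auto simp: successively_Cons)
  have "fst (hd (ps @ [(e, n)])) = hd (map fst ps @ [e])" by (cases ps) auto
  moreover have "fst (hd (sheared k ps e @ [(e, n')])) = hd (map fst ps @ [e])"
    by (cases "sheared k ps e"; cases ps) auto
  moreover have "spaced p (hd (ps @ [(e, n)]))"
    using Cons.prems by (auto simp: successively_Cons)
  ultimately have "spaced (s, i + k * shift s (hd (map fst ps @ [e])))
      (hd (sheared k ps e @ [(e, n')]))"
    by (auto simp: spaced_def p shift_def split: if_splits)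
  then show ?case using IH by (simp add: p successively_Cons)
qed simp

lemma curve_length_syllables:
  assumes "ps \<noteq> []" "successively spaced (ps @ [hd ps])"
  shows "curve_length (vertex_label (curve_of (syllables m ps)) (replicate k m)) =
    length (syllables m (sheared (int k) ps (fst (hd ps))))"
proof (rule curve_length_eq)
  let ?qs = "sheared (int k) ps (fst (hd ps))"
  obtain s n where hd: "hd ps = (s, n)" by fastforce
  have "fst (hd ?qs) = s" using assms(1) hd by (cases ps) auto
  then obtain n' where hd': "hd ?qs = (s, n')" by (cases "hd ?qs") auto
  have "successively spaced (?qs @ [hd ?qs])"
    unfolding hd' using spaced_sheared[of ps s n] assms(2) by (simp add: hd)
  then have "successively spaced (?qs @ ?qs)"
    using assms(1) by (auto simp: successively_append_iff)
  then show "reduced (syllables m ?qs @ syllables m ?qs)"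
    using reduced_syllables[of "?qs @ ?qs" m] by simp
  show "curve_of (syllables m ?qs) = vertex_label (curve_of (syllables m ps)) (replicate k m)"
    by (simp add: vertex_label_curve_of curve_of_twists_syllables[OF assms(1)])
qed

text \<open>A gap exponent n + k d with d in {-1, 0, 1} no longer changes its sign once k >= |n|, so
  its absolute value is linear from there on.\<close>

lemma length_sheared_eventually_linear:
  "\<exists>k0 c s. \<forall>k \<ge> k0. int (length (syllables m (sheared (int k) ps e))) = c + s * int k"
proof (induction ps)
  case Nil
  show ?case by (intro exI[of _ 0]) simp
next
  case (Cons p ps)
  then obtain k0 c s where IH:
    "\<And>k. k \<ge> k0 \<Longrightarrow> int (length (syllables m (sheared (int k) ps e))) = c + s * int k"
    by blast
  obtain t n where p: "p = (t, n)" by fastforce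
  define d where "d = shift t (hd (map fst ps @ [e]))"
  have d: "d = 1 \<or> d = -1 \<or> d = 0" by (auto simp: d_def shift_def)
  have "int (length (syllables m (sheared (int k) (p # ps) e))) =
      (c + 1 + (if d = 0 then \<bar>n\<bar> else d * n)) + (s + \<bar>d\<bar>) * int k"
    if "k \<ge> max k0 (nat \<bar>n\<bar>)" for k
  proof -
    have "k0 \<le> k" "\<bar>n\<bar> \<le> int k" using that by auto
    then have "\<bar>n + int k * d\<bar> = (if d = 0 then \<bar>n\<bar> else d * n) + \<bar>d\<bar> * int k"
      using d by auto
    moreover have "int (length (syllables m (sheared (int k) (p # ps) e))) =
        1 + \<bar>n + int k * d\<bar> + int (length (syllables m (sheared (int k) ps e)))"
      by (simp add: p d_def)
    ultimately show ?thesis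
      using IH[OF \<open>k0 \<le> k\<close>] by (simp only:) (simp add: algebra_simps)
  qed
  then show ?case by blast
qed

text \<open>The witness is a representative with the least number of syllables.\<close>

lemma spaced_representative:
  assumes "\<nexists>n. \<gamma> = curve_of (letter_pow (fixed_letter m) n)"
  obtains ps where "ps \<noteq> []" "successively spaced (ps @ [hd ps])" "\<gamma> = curve_of (syllables m ps)"
proof -
  let ?x = "letter_pow (fixed_letter m)"
  define R where "R ps \<longleftrightarrow> (\<exists>n. \<gamma> = curve_of (?x n @ syllables m ps))" for ps
  obtain w where "\<gamma> = curve_of w" using cyclically_reduced_representative by metis
  then have "\<exists>ps. R ps"
    unfolding R_def using free_eq_letter_pow_syllables curve_of_free_eq by metis
  then obtain qs where qs: "R qs" and min: "\<And>ps. R ps \<Longrightarrow> length qs \<le> length ps"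
    using ex_has_least_nat[of R _ length] by metis
  obtain n where n: "\<gamma> = curve_of (?x n @ syllables m qs)" using qs by (auto simp: R_def)
  have "qs \<noteq> []" using n assms by auto
  then obtain ps0 s i where qs_eq: "qs = ps0 @ [(s, i)]" by (metis rev_exhaust surj_pair)
  define ps where "ps = ps0 @ [(s, i + n)]"
  have "\<gamma> = curve_of (syllables m ps0 @ [moved_letter m s] @ ?x i @ ?x n)"
    unfolding n qs_eq by (subst curve_of_rotate) simp
  also have "\<dots> = curve_of (syllables m ps)"
    using free_eq_ctxt[OF free_eq_letter_pow_add, of "syllables m ps0 @ [moved_letter m s]" _ i n "[]"]
    by (intro curve_of_free_eq) (simp add: ps_def)
  finally have \<gamma>: "\<gamma> = curve_of (syllables m ps)" .
  have len: "length ps = length qs" by (simp add: ps_def qs_eq)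
  have ne: "ps \<noteq> []" by (simp add: ps_def)
  have "successively spaced (ps @ [hd ps])"
  proof (rule ccontr)
    assume "\<not> ?thesis"
    then obtain j where j: "Suc j < length (ps @ [hd ps])"
      "\<not> spaced ((ps @ [hd ps]) ! j) ((ps @ [hd ps]) ! Suc j)"
      unfolding successively_conv_nth by auto
    define as where "as = take j ps"
    have "j < length ps" using j(1) by simp
    then have split: "ps = as @ ps ! j # drop (Suc j) ps"
      unfolding as_def by (rule id_take_nth_drop)
    have nth: "(ps @ [hd ps]) ! j = ps ! j" using \<open>j < length ps\<close> by (simp add: nth_append)
    obtain s where s: "ps ! j = (s, 0)" "fst ((ps @ [hd ps]) ! Suc j) = (\<not> s)"
      using j(2) unfolding nth spaced_def by (cases "ps ! j") auto
    \<comment> \<open>A violation is a moved letter followed cyclically by its inverse. Cancelling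
      the pair leaves two syllables fewer, against minimality; in the first case the pair wraps
      around the end of the list.\<close>
    have "\<exists>n' bs. length bs < length ps \<and> \<gamma> = curve_of (?x n' @ syllables m bs)"
    proof (cases "drop (Suc j) ps")
      case Nil
      then have "Suc j = length ps" using \<open>j < length ps\<close> by simp
      then have "fst (hd ps) = (\<not> s)" using s(2) by (simp add: nth_append)
      moreover have ps: "ps = as @ [(s, 0)]" using split s(1) Nil by simp
      ultimately obtain n' as' where as: "as = (\<not> s, n') # as'"
        by (cases as) auto
      have "\<gamma> = curve_of ([moved_letter m s] @ moved_letter m (\<not> s) # ?x n' @ syllables m as')"
        unfolding \<gamma> ps as by (subst curve_of_rotate) simp
      also have "\<dots> = curve_of (?x n' @ syllables m as')"
        using free_eq_cancel_pair(2)[of "moved_letter m s"] by (intro curve_of_free_eq) simp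
      finally show ?thesis
        by (intro exI[of _ n'] exI[of _ as']) (simp add: ps as)
    next
      case (Cons q bs)
      then have "Suc j < length ps" "q = ps ! Suc j"
        using nth_via_drop[OF Cons] by (auto intro: ccontr)
      then have "fst q = (\<not> s)" using s(2) by (simp add: nth_append)
      then obtain n' where q: "q = (\<not> s, n')" by (cases q) simp
      have ps: "ps = as @ [(s, 0), (\<not> s, n')] @ bs" using split s(1) Cons q by simp
      have "\<gamma> = curve_of ([moved_letter m s] @ moved_letter m (\<not> s) #
          ?x n' @ syllables m bs @ syllables m as)"
        unfolding \<gamma> ps using curve_of_rotate[of "syllables m as"] by simp
      also have "\<dots> = curve_of (?x n' @ syllables m (bs @ as))"
        using free_eq_cancel_pair(2)[of "moved_letter m s"] by (intro curve_of_free_eq) simp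
      finally show ?thesis
        by (intro exI[of _ n'] exI[of _ "bs @ as"]) (simp add: ps)
    qed
    then obtain bs where "length bs < length ps" "R bs" unfolding R_def by blast
    with min[of bs] len show False by simp
  qed
  with that \<gamma> ne show ?thesis by blast
qed

lemma curve_length_eventually_linear:
  "\<exists>k0 c s. \<forall>k \<ge> k0. int (curve_length (vertex_label \<gamma> (replicate k m))) = c + s * int k"
proof (cases "\<exists>n. \<gamma> = curve_of (letter_pow (fixed_letter m) n)")
  case True
  then have "vertex_label \<gamma> (replicate k m) = \<gamma>" for k
    by (auto simp: vertex_label_curve_of twists_letter_pow)
  then show ?thesis by (intro exI[of _ 0] exI[of _ "int (curve_length \<gamma>)"]) simp
next
  case False
  then obtain ps where "ps \<noteq> []" "successively spaced (ps @ [hd ps])"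
    "\<gamma> = curve_of (syllables m ps)"
    by (rule spaced_representative)
  then show ?thesis
    using curve_length_syllables length_sheared_eventually_linear by metis
qed

subsection \<open>Coprime pairs and vertices\<close>

abbreviation total :: "nat \<times> nat \<Rightarrow> nat" where
  "total x \<equiv> fst x + snd x"

lemma twist_vec_inject [simp]: "twist_vec m x = twist_vec m y \<longleftrightarrow> x = y"
  by (cases m; cases x; cases y) auto

lemma twists_vec_inject [simp]: "twists_vec u x = twists_vec u y \<longleftrightarrow> x = y"
  by (induction u) auto

lemma twists_vec_pos:
  assumes "0 < fst x" "0 < snd x"
  shows "0 < fst (twists_vec u x) \<and> 0 < snd (twists_vec u x)"
proof (induction u)
  case (Cons m u)
  then show ?case by (cases m; cases "twists_vec u x") auto
qed (use assms in simp)

lemma total_twist_vec_gt: "0 < fst x \<Longrightarrow> 0 < snd x \<Longrightarrow> total x < total (twist_vec m x)"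
  by (cases m; cases x) auto

lemma total_twists_vec_ge: "total x \<le> total (twists_vec u x)"
proof (induction u)
  case (Cons m u)
  then show ?case by (cases m; cases "twists_vec u x") auto
qed simp

text \<open>The outermost twist shows in the result, as the entry that received the sum is the
  larger one, and can be undone. The total grows strictly on positive vectors, which separates the
  empty product from all others.\<close>

lemma twists_vec_eq_iff:
  assumes "0 < fst x" "0 < snd x"
  shows "twists_vec u x = twists_vec v x \<longleftrightarrow> u = v"
proof
  have ne: "twists_vec (m # u) x \<noteq> x" for m u
    using total_twist_vec_gt[of "twists_vec u x" m] twists_vec_pos[OF assms, of u]
      total_twists_vec_ge[of x u]
    by (metis leD twists_vec_simps(2))
  show "twists_vec u x = twists_vec v x \<Longrightarrow> u = v"
  proof (induction u arbitrary: v)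
    case Nil
    show ?case
    proof (cases v)
      case (Cons m v')
      then show ?thesis using Nil ne[of m v'] by (metis twists_vec_simps(1))
    qed simp
  next
    case (Cons m u)
    show ?case
    proof (cases v)
      case Nil
      then show ?thesis using ne Cons.prems by (metis twists_vec_simps(1))
    next
      case v: (Cons m' v')
      have "m = m'"
        using Cons.prems twists_vec_pos[OF assms, of u] twists_vec_pos[OF assms, of v']
        unfolding v
        by (cases m; cases m'; cases "twists_vec u x"; cases "twists_vec v' x") auto
      then show ?thesis using Cons v by simp
    qed
  qed
qed simp

text \<open>The pair (|M a|, |M b|): the column sums of the matrix of M acting on letter
  counts.\<close>

definition weights :: "vertex \<Rightarrow> nat \<times> nat" where
  "weights u = (total (twists_vec u (1, 0)), total (twists_vec u (0, 1)))"

lemma total_twists_vec: "total (twists_vec u (p, q)) = p * fst (weights u) + q * snd (weights u)"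
proof -
  have "twists_vec u (p, q) =
      (p * fst (twists_vec u (1, 0)) + q * fst (twists_vec u (0, 1)),
       p * snd (twists_vec u (1, 0)) + q * snd (twists_vec u (0, 1)))"
  proof (induction u)
    case (Cons m u)
    then show ?case
      by (cases m; cases "twists_vec u (1, 0)"; cases "twists_vec u (0, 1)")
        (auto simp: algebra_simps)
  qed simp
  then show ?thesis by (simp add: weights_def algebra_simps)
qed

text \<open>A factor appended on the right is applied first, to a and b themselves, so it acts as a
  step of the subtractive Euclidean algorithm run backwards. Inductions on weights therefore peel
  off the last list entry.\<close>

lemma weights_snoc:
  "weights (u @ [TL]) = (fst (weights u), fst (weights u) + snd (weights u))"
  "weights (u @ [TR]) = (fst (weights u) + snd (weights u), snd (weights u))"
  using total_twists_vec[of u 1 1] unfolding weights_def by simp_all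

lemma weights_Nil [simp]: "weights [] = (1, 1)"
  by (simp add: weights_def)

lemma weights_pos: "0 < fst (weights u)" "0 < snd (weights u)"
  using total_twists_vec_ge[of "(1, 0)" u] total_twists_vec_ge[of "(0, 1)" u]
  by (auto simp: weights_def)

lemma coprime_weights: "coprime (fst (weights u)) (snd (weights u))"
proof (induction u rule: rev_induct)
  case (snoc m u)
  then show ?case by (cases m) (simp_all add: weights_snoc coprime_iff_gcd_eq_1)
qed simp

text \<open>The larger weight reveals the innermost twist, and equal weights occur only at the root.
  With \<open>weights_surj\<close> this is the Calkin-Wilf enumeration of coprime pairs.\<close>

lemma inj_weights: "inj weights"
proof (rule injI)
  show "weights u = weights v \<Longrightarrow> u = v" for u v
  proof (induction u arbitrary: v rule: rev_induct)
    case Nil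
    then show ?case
    proof (cases v rule: rev_cases)
      case (snoc v' m)
      with Nil weights_pos[of v'] show ?thesis by (cases m) (auto simp: weights_snoc)
    qed simp
  next
    case (snoc m u)
    show ?case
    proof (cases v rule: rev_cases)
      case Nil
      with snoc.prems weights_pos[of u] show ?thesis by (cases m) (auto simp: weights_snoc)
    next
      case v: (snoc v' m')
      have "m = m'" "weights u = weights v'"
        using snoc.prems weights_pos[of u] weights_pos[of v'] unfolding v
        by (cases m; cases m'; auto simp: weights_snoc prod_eq_iff)+
      with snoc.IH v show ?thesis by blast
    qed
  qed
qed

text \<open>The subtractive Euclidean algorithm.\<close>

lemma weights_surj:
  assumes "0 < x" "0 < y" "coprime x y"
  shows "\<exists>u. weights u = (x, y)"
  using assms
proof (induction "x + y" arbitrary: x y rule: less_induct)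
  case less
  consider "x = y" | "x < y" | "y < x" by linarith
  then show ?case
  proof cases
    case 1
    with less.prems have "x = 1" "y = 1" by auto
    then show ?thesis by (intro exI[of _ "[]"]) simp
  next
    case 2
    then have "coprime x (y - x)"
      using less.prems(3) by (metis coprime_iff_gcd_eq_1 gcd_diff1_nat gcd.commute less_imp_le)
    with 2 less obtain u where "weights u = (x, y - x)"
      by (metis add_less_cancel_left diff_less zero_less_diff)
    then show ?thesis using 2 by (intro exI[of _ "u @ [TL]"]) (simp add: weights_snoc)
  next
    case 3
    then have "coprime (x - y) y"
      using less.prems(3) by (metis coprime_iff_gcd_eq_1 gcd_diff1_nat less_imp_le)
    with 3 less obtain u where "weights u = (x - y, y)"
      by (metis add_less_cancel_right diff_less zero_less_diff)
    then show ?thesis using 3 by (intro exI[of _ "u @ [TR]"]) (simp add: weights_snoc)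
  qed
qed

text \<open>\<open>weights\<close> matches all vertices, root and powers of one twist included, with
  coprime pairs, and turns the total into the linear form of \<open>phi\<close>. Both coordinates of
  a solution are at most \<open>N\<close>, which gives finiteness.\<close>

lemma card_total_eq_phi:
  fixes p q :: nat
  assumes "0 < p" "0 < q"
  defines "D \<equiv> \<lambda>N. {u. int (total (twists_vec u (p, q))) = N}"
  shows "finite (D N)" "card (D N) = phi (int p) (int q) N"
proof -
  let ?A = "{(x :: int, y :: int). x > 0 \<and> y > 0 \<and> int p * x + int q * y = N \<and> gcd x y = 1}"
  let ?f = "\<lambda>u. map_prod int int (weights u)"
  have "inj ?f"
    using inj_weights by (auto simp: inj_def map_prod_def split_beta prod_eq_iff)
  then have inj: "inj_on ?f (D N)" by (rule inj_on_subset) simp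
  have image: "?f ` D N = ?A"
  proof (intro equalityI subsetI)
    fix z assume "z \<in> ?f ` D N"
    then obtain u where u: "u \<in> D N" "z = ?f u" by blast
    have "gcd (int (fst (weights u))) (int (snd (weights u))) = 1"
      using coprime_weights[of u] by simp
    then show "z \<in> ?A"
      using u weights_pos[of u] total_twists_vec[of u p q] unfolding D_def
      by (auto simp: map_prod_def split_beta simp flip: of_nat_mult of_nat_add)
  next
    fix z assume "z \<in> ?A"
    then obtain x y where z: "z = (x, y)" "x > 0" "y > 0" "int p * x + int q * y = N" "gcd x y = 1"
      by auto
    then obtain a b where ab: "x = int a" "y = int b" "0 < a" "0 < b"
      by (metis pos_int_cases of_nat_0_less_iff)
    with z have "coprime a b" by (simp add: coprime_iff_gcd_eq_1)
    then obtain u where u: "weights u = (a, b)" using weights_surj ab by blast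
    then have "u \<in> D N"
      using z ab total_twists_vec[of u p q] by (simp add: D_def flip: of_nat_mult of_nat_add)
    moreover have "z = ?f u" using u z ab by simp
    ultimately show "z \<in> ?f ` D N" by blast
  qed
  have "?A \<subseteq> {1..N} \<times> {1..N}"
  proof
    fix z assume "z \<in> ?A"
    then obtain x y where z: "z = (x, y)" "x > 0" "y > 0" "int p * x + int q * y = N" by auto
    have "1 * x \<le> int p * x" "1 * y \<le> int q * y"
      using z assms by (intro mult_right_mono; simp)+
    moreover have "0 < int p * x" "0 < int q * y" using z assms by auto
    ultimately have "x \<le> N" "y \<le> N" using z(4) by linarith+
    then show "z \<in> {1..N} \<times> {1..N}" using z by auto
  qed
  then have "finite ?A" by (rule finite_subset) simp
  then have "finite (?f ` D N)" unfolding image .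
  then show "finite (D N)" by (rule finite_imageD[OF _ inj])
  show "card (D N) = phi (int p) (int q) N"
    unfolding phi_def image[symmetric] by (rule card_image[OF inj, symmetric])
qed

text \<open>In the linear range each length is attained once or never, according to a residue class.
  The index starts at 1 because \<open>k = 0\<close> is the root, shared by both twists.\<close>

lemma card_eventually_linear:
  fixes g :: "nat \<Rightarrow> int" and q :: nat
  assumes "0 < q" and lin: "\<And>k. k \<ge> k0 \<Longrightarrow> g k = c + int q * int k"
  shows "\<exists>L0. \<forall>L \<ge> L0. finite {k. 1 \<le> k \<and> g k = L} \<and>
    int (card {k. 1 \<le> k \<and> g k = L}) = of_bool (int q dvd L - c)"
proof (intro exI allI impI)
  let ?B = "Max (g ` {..k0})"
  \<comment> \<open>The first bound exceeds all values up to \<open>k0\<close>; the second pushes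
    the solution of the linear equation beyond \<open>k0\<close>.\<close>
  fix L assume L: "L \<ge> max (?B + 1) (c + int q * int k0 + 1)"
  have low: "g k < L" if "k \<le> k0" for k
  proof -
    have "g k \<le> ?B" using that by (intro Max_ge) auto
    with L show ?thesis by simp
  qed
  have eq: "{k. 1 \<le> k \<and> g k = L} = {k. int q * int k = L - c}"
  proof (intro equalityI subsetI; clarify)
    fix k assume "1 \<le> k" "L = g k"
    then show "int q * int k = g k - c" using low[of k] lin[of k] by (cases "k \<le> k0") auto
  next
    fix k assume k: "int q * int k = L - c"
    then have "int q * int k0 < int q * int k" using L by simp
    then have "k0 < k" using assms(1) by simp
    then show "1 \<le> k \<and> g k = L" using lin[of k] k by simp
  qed
  show "finite {k. 1 \<le> k \<and> g k = L} \<and>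
      int (card {k. 1 \<le> k \<and> g k = L}) = of_bool (int q dvd L - c)"
  proof (cases "int q dvd L - c")
    case True
    then obtain t where t: "L - c = int q * t" by blast
    have "0 \<le> int q * int k0" by simp
    then have "0 < int q * t" using t L by linarith
    then have "0 < t" using assms(1) by (simp add: zero_less_mult_iff)
    then have "{k. int q * int k = L - c} = {nat t}" using t assms(1) by auto
    then show ?thesis using True eq by simp
  next
    case False
    then have "{k. int q * int k = L - c} = {}" by (metis (mono_tags, lifting) dvd_triv_left empty_Collect_eq)
    then show ?thesis unfolding eq using False by simp
  qed
qed

section \<open>Generic vertices and powers of one twist\<close>

definition generic :: "vertex set" where
  "generic = {u. TL \<in> set u \<and> TR \<in> set u}"

lemma not_generic: "u \<notin> generic \<Longrightarrow> \<exists>k m. u = replicate k m"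
proof (induction u)
  case (Cons m u)
  have "x = m" if "x \<in> set (m # u)" for x
    using that Cons.prems twist.exhaust[of x] by (cases m) (auto simp: generic_def)
  then show ?case by (metis replicate_eqI)
qed simp

lemma replicate_not_generic: "replicate k m \<notin> generic"
  by (cases m) (auto simp: generic_def)

lemma card_vertices_split:
  fixes f :: "vertex \<Rightarrow> int"
  assumes "f [] \<noteq> L" "finite {u \<in> generic. f u = L}"
    and "\<And>m. finite {k. 1 \<le> k \<and> f (replicate k m) = L}"
  shows "finite {u. f u = L}"
    and "card {u. f u = L} = card {u \<in> generic. f u = L} +
      card {k. 1 \<le> k \<and> f (replicate k TL) = L} + card {k. 1 \<le> k \<and> f (replicate k TR) = L}"
proof -
  let ?G = "{u \<in> generic. f u = L}"
  let ?K = "\<lambda>m. {k. 1 \<le> k \<and> f (replicate k m) = L}"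
  let ?R = "\<lambda>m. (\<lambda>k. replicate k m) ` ?K m"
  have split: "{u. f u = L} = (?G \<union> ?R TL) \<union> ?R TR"
  proof
    show "(?G \<union> ?R TL) \<union> ?R TR \<subseteq> {u. f u = L}" by auto
    show "{u. f u = L} \<subseteq> (?G \<union> ?R TL) \<union> ?R TR"
    proof
      fix u assume u: "u \<in> {u. f u = L}"
      show "u \<in> (?G \<union> ?R TL) \<union> ?R TR"
      proof (cases "u \<in> generic")
        case False
        then obtain k m where k: "u = replicate k m" using not_generic by blast
        with u assms(1) have "k \<noteq> 0" by (cases k) auto
        then have "k \<in> ?K m" using k u by simp
        then have "u \<in> ?R m" unfolding k by (rule imageI)
        then show ?thesis by (cases m) blast+
      qed (use u in blast)
    qed
  qed
  have "?G \<inter> ?R m = {}" for m using replicate_not_generic by blast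
  moreover have "?R TL \<inter> ?R TR = {}" by auto
  ultimately have "?G \<inter> ?R TL = {}" "(?G \<union> ?R TL) \<inter> ?R TR = {}" by blast+
  moreover have "card (?R m) = card (?K m)" for m
    by (intro card_image inj_onI) simp
  moreover have "finite (?R m)" for m
    using assms(3)[of m] by (rule finite_imageI)
  ultimately show "finite {u. f u = L}"
    and "card {u. f u = L} = card ?G + card (?K TL) + card (?K TR)"
    unfolding split using assms(2) by (simp_all add: card_Un_disjoint)
qed

text \<open>Without cancellation, L adds one letter for each b or B, and R one for each a or
  A.\<close>

fun slope :: "twist \<Rightarrow> nat \<times> nat \<Rightarrow> nat" where
  "slope TL x = snd x"
| "slope TR x = fst x"

lemma twists_vec_replicate:
  "twists_vec (replicate k TL) (p, q) = (p + k * q, q)"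
  "twists_vec (replicate k TR) (p, q) = (p, q + k * p)"
  by (induction k) auto

lemma total_twists_vec_replicate:
  "total (twists_vec (replicate k m) x) = total x + k * slope m x"
  by (cases m; cases x) (auto simp: twists_vec_replicate)

text \<open>
  Compared with the count of \<open>card_total_eq_phi\<close>, only the vertices that are powers of one twist
  contribute differently.
\<close>

lemma card_vertices_eventually:
  fixes f :: "vertex \<Rightarrow> int" and p q :: nat and c :: "twist \<Rightarrow> int"
  assumes pq: "0 < p" "0 < q"
    and gen: "\<And>u. u \<in> generic \<Longrightarrow> f u = d + int (total (twists_vec u (p, q)))"
    and pow: "\<And>m. \<exists>k0. \<forall>k \<ge> k0. f (replicate k m) = c m + int (slope m (p, q)) * int k"
  shows "\<exists>L0. \<forall>L \<ge> L0. finite {u. f u = L} \<and>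
    int (card {u. f u = L}) = int (phi (int p) (int q) (L - d)) +
      (of_bool (int q dvd L - c TL) - of_bool (int q dvd L - (d + int p + int q)) +
       of_bool (int p dvd L - c TR) - of_bool (int p dvd L - (d + int p + int q)))"
proof -
  \<comment> \<open>\<open>?h\<close> extends the generic formula to all vertices, so its fibres are
    counted by \<open>phi\<close>; its value at the root, \<open>d + p + q\<close>, is the intercept
    of both its progressions. Splitting the fibres of \<open>f\<close> and of \<open>?h\<close> and
    subtracting leaves the correction.\<close>
  let ?h = "\<lambda>u. d + int (total (twists_vec u (p, q)))"
  let ?K = "\<lambda>f m L. {k. 1 \<le> k \<and> f (replicate k m) = (L :: int)}"
  have slope: "0 < slope m (p, q)" for m using pq by (cases m) auto
  have "\<exists>L0. \<forall>L \<ge> L0. finite (?K f m L) \<and>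
      int (card (?K f m L)) = of_bool (int (slope m (p, q)) dvd L - c m)" for m
  proof -
    obtain k0 where "\<And>k. k \<ge> k0 \<Longrightarrow> f (replicate k m) = c m + int (slope m (p, q)) * int k"
      using pow by blast
    then show ?thesis by (rule card_eventually_linear[OF slope])
  qed
  then have f: "\<forall>m. \<exists>L0. \<forall>L \<ge> L0. finite (?K f m L) \<and>
      int (card (?K f m L)) = of_bool (int (slope m (p, q)) dvd L - c m)" by blast
  have "\<exists>L0. \<forall>L \<ge> L0. finite (?K ?h m L) \<and>
      int (card (?K ?h m L)) = of_bool (int (slope m (p, q)) dvd L - (d + int p + int q))" for m
    by (rule card_eventually_linear[OF slope, of 0]) (simp add: total_twists_vec_replicate)
  then have h: "\<forall>m. \<exists>L0. \<forall>L \<ge> L0. finite (?K ?h m L) \<and>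
      int (card (?K ?h m L)) = of_bool (int (slope m (p, q)) dvd L - (d + int p + int q))"
    by blast
  obtain M where M: "\<And>m L. L \<ge> M m \<Longrightarrow> finite (?K f m L) \<and>
      int (card (?K f m L)) = of_bool (int (slope m (p, q)) dvd L - c m)"
    using choice[OF f] by blast
  obtain N where N: "\<And>m L. L \<ge> N m \<Longrightarrow> finite (?K ?h m L) \<and>
      int (card (?K ?h m L)) = of_bool (int (slope m (p, q)) dvd L - (d + int p + int q))"
    using choice[OF h] by blast
  define L0 where
    "L0 = max (max (M TL) (M TR)) (max (max (N TL) (N TR)) (max (f [] + 1) (?h [] + 1)))"
  show ?thesis
  proof (intro exI[of _ L0] allI impI)
    fix L assume "L \<ge> L0"
    then have "L \<ge> M TL" "L \<ge> M TR" "L \<ge> N TL" "L \<ge> N TR" "f [] < L" "?h [] < L"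
      unfolding L0_def by linarith+
    then have L: "L \<ge> M m" "L \<ge> N m" "f [] \<noteq> L" "?h [] \<noteq> L" for m
      by (cases m; simp)+
    have hL: "{u. ?h u = L} = {u. int (total (twists_vec u (p, q))) = L - d}" by auto
    have fin: "finite {u. ?h u = L}" unfolding hL by (rule card_total_eq_phi[OF pq])
    have G: "{u \<in> generic. f u = L} = {u \<in> generic. ?h u = L}" using gen by auto
    have finG: "finite {u \<in> generic. ?h u = L}" by (rule finite_subset[OF _ fin]) auto
    have finh: "finite (?K ?h m L)" and finf: "finite (?K f m L)" for m
      using M[OF L(1)] N[OF L(2)] by blast+
    note ch = card_vertices_split(2)[of ?h, OF L(4) finG finh]
    note cf = card_vertices_split[of f, OF L(3) finG[folded G] finf]
    have "card {u. ?h u = L} = phi (int p) (int q) (L - d)"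
      unfolding hL by (rule card_total_eq_phi[OF pq])
    then show "finite {u. f u = L} \<and>
      int (card {u. f u = L}) = int (phi (int p) (int q) (L - d)) +
        (of_bool (int q dvd L - c TL) - of_bool (int q dvd L - (d + int p + int q)) +
         of_bool (int p dvd L - c TR) - of_bool (int p dvd L - (d + int p + int q)))"
      using ch cf M[OF L(1), of TL] M[OF L(1), of TR] N[OF L(2), of TL] N[OF L(2), of TR]
      by (simp add: G)
  qed
qed

subsection \<open>Counting the curves below a stable curve\<close>

definition piece_counts :: "(int \<times> word) list \<Rightarrow> nat \<times> nat" where
  "piece_counts ps = counts (concat (map snd ps))"

lemma piece_counts_twists:
  "piece_counts (map (map_prod id (twists u)) ps) = twists_vec u (piece_counts ps)"
proof -
  have "concat (map snd (map (map_prod id (twists u)) ps)) = twists u (concat (map snd ps))"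
    by (induction ps) auto
  then show ?thesis by (simp add: piece_counts_def counts_twists)
qed

lemma length_stable_word:
  "length (stable_word ps) =
     (\<Sum>p\<leftarrow>ps. length (word_pow z_word (fst p))) + total (piece_counts ps)"
proof -
  have "total (piece_counts ps) = length (concat (map snd ps))"
    by (simp add: piece_counts_def counts_def length_eq_counts)
  moreover have "length (stable_word ps) =
      (\<Sum>p\<leftarrow>ps. length (word_pow z_word (fst p))) + length (concat (map snd ps))"
    by (induction ps) (auto simp: stable_word_def)
  ultimately show ?thesis by simp
qed

lemma total_piece_counts_pos:
  assumes "admissible ps"
  shows "0 < total (piece_counts ps)"
proof -
  obtain p ps' where ps: "ps = p # ps'" "snd p \<noteq> []"
    using assms unfolding admissible_def by (cases ps) auto
  have "total (piece_counts ps) = length (concat (map snd ps))"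
    by (simp add: piece_counts_def counts_def length_eq_counts)
  with ps show ?thesis by simp
qed

lemma curve_length_counts:
  assumes "reduced (w @ w)" "curve_of w = \<gamma>"
  shows "curve_length \<gamma> = total (counts w)"
  using curve_length_eq[OF assms] by (simp add: counts_def length_eq_counts)

lemma counts_eq:
  assumes "reduced (v @ v)" "reduced (w @ w)" "curve_of v = curve_of w"
  shows "counts v = counts w"
proof -
  have inv: "letter_inv l \<in> {la, lA} \<longleftrightarrow> l \<in> {la, lA}" "letter_inv l \<in> {lb, lB} \<longleftrightarrow> l \<in> {lb, lB}" for l
    by (cases l; simp)+
  have "acount v = acount w" "bcount v = bcount w"
    unfolding acount_def bcount_def
    by (intro length_filter_cyclically_reduced_eq[OF assms] inv)+
  then show ?thesis by (simp add: counts_def)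
qed

text \<open>Applying L R to both curves makes both vertices generic, whatever they were. Letter
  counts of cyclically reduced words are invariants of the curve, so the twisted count vectors agree
  and determine the vertex.\<close>

lemma inj_vertex_label:
  assumes adm: "admissible ps" and pos: "0 < fst (piece_counts ps)" "0 < snd (piece_counts ps)"
  shows "inj (vertex_label (curve_of (stable_word ps)))"
proof (rule injI)
  let ?\<gamma> = "curve_of (stable_word ps)" and ?x = "piece_counts ps"
  obtain K where K: "\<And>u. TL \<in> set u \<Longrightarrow> TR \<in> set u \<Longrightarrow>
      \<exists>w. reduced (w @ w) \<and> curve_of w = vertex_label ?\<gamma> u \<and>
        counts w = (2 * K + fst (twists_vec u ?x), 2 * K + snd (twists_vec u ?x))"
    using generic_representative[OF adm] unfolding piece_counts_def by blast
  fix u v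
  assume eq: "vertex_label ?\<gamma> u = vertex_label ?\<gamma> v"
  let ?u = "[TL, TR] @ u" and ?v = "[TL, TR] @ v"
  obtain w where w: "reduced (w @ w)" "curve_of w = vertex_label ?\<gamma> ?u"
      "counts w = (2 * K + fst (twists_vec ?u ?x), 2 * K + snd (twists_vec ?u ?x))"
    using K[of ?u] by auto
  obtain w' where w': "reduced (w' @ w')" "curve_of w' = vertex_label ?\<gamma> ?v"
      "counts w' = (2 * K + fst (twists_vec ?v ?x), 2 * K + snd (twists_vec ?v ?x))"
    using K[of ?v] by auto
  have "curve_of w = curve_of w'" using w(2) w'(2) eq by simp
  then have "counts w = counts w'" by (rule counts_eq[OF w(1) w'(1)])
  then have "twists_vec ?u ?x = twists_vec ?v ?x" using w(3) w'(3) by (simp add: prod_eq_iff)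
  then have "?u = ?v" using twists_vec_eq_iff[OF pos] by blast
  then show "u = v" by simp
qed

lemma slope_unique:
  fixes a s :: int
  assumes "\<And>k. k \<ge> k0 \<Longrightarrow> a * int k \<le> c + s * int k \<and> c + s * int k \<le> b + a * int k"
  shows "s = a"
proof (rule ccontr)
  define k where "k = k0 + nat \<bar>b\<bar> + nat \<bar>c\<bar> + 1"
  have k: "int k > \<bar>b\<bar> + \<bar>c\<bar>" "k \<ge> k0" by (auto simp: k_def)
  have bound: "a * int k \<le> c + s * int k" "c + s * int k \<le> b + a * int k"
    using assms[OF k(2)] by auto
  assume "s \<noteq> a"
  then consider "s - a \<ge> 1" | "a - s \<ge> 1" by linarith
  then show False
  proof cases
    case 1
    then have "1 * int k \<le> (s - a) * int k" by (intro mult_right_mono) auto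
    with bound k show False by (simp add: algebra_simps)
  next
    case 2
    then have "1 * int k \<le> (a - s) * int k" by (intro mult_right_mono) auto
    with bound k show False by (simp add: algebra_simps)
  qed
qed

text \<open>
  The slope is found by comparison with the word length from above and with
  the neighbouring generic vertex from below.
\<close>

lemma curve_length_twist_power:
  assumes adm: "admissible ps"
  shows "\<exists>k0 c. \<forall>k \<ge> k0. int (curve_length (vertex_label (curve_of (stable_word ps)) (replicate k m))) =
    c + int (slope m (piece_counts ps)) * int k"
proof -
  let ?\<gamma> = "curve_of (stable_word ps)" and ?x = "piece_counts ps"
  let ?len = "\<lambda>u. curve_length (vertex_label ?\<gamma> u)"
  let ?m' = "if m = TL then TR else TL"
  obtain k0 c s where lin: "\<And>k. k \<ge> k0 \<Longrightarrow> int (?len (replicate k m)) = c + s * int k"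
    using curve_length_eventually_linear[of ?\<gamma> m] by blast
  obtain K where K: "\<And>u. TL \<in> set u \<Longrightarrow> TR \<in> set u \<Longrightarrow>
      \<exists>w. reduced (w @ w) \<and> curve_of w = vertex_label ?\<gamma> u \<and>
        counts w = (2 * K + fst (twists_vec u ?x), 2 * K + snd (twists_vec u ?x))"
    using generic_representative[OF adm] unfolding piece_counts_def by blast
  let ?E = "(\<Sum>p\<leftarrow>ps. length (word_pow z_word (fst p))) + total ?x"
  have upper: "?len (replicate k m) \<le> ?E + k * slope m ?x" for k
  proof -
    let ?ps = "map (map_prod id (twists (replicate k m))) ps"
    have "vertex_label ?\<gamma> (replicate k m) = curve_of (stable_word ?ps)"
      by (simp add: vertex_label_curve_of curve_of_free_eq[OF free_eq_twists_stable_word])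
    then have "?len (replicate k m) \<le> length (stable_word ?ps)"
      using curve_length_le[of "stable_word ?ps"] by simp
    also have "\<dots> = ?E + k * slope m ?x"
      by (simp add: length_stable_word piece_counts_twists total_twists_vec_replicate comp_def)
    finally show ?thesis .
  qed
  have lower: "k * slope m ?x \<le> ?len (replicate k m)" if "k \<ge> 1" for k
  proof -
    let ?u = "?m' # replicate k m"
    have "TL \<in> set ?u" "TR \<in> set ?u" using that by (cases m; cases k; auto)+
    then obtain w where w: "reduced (w @ w)" "curve_of w = vertex_label ?\<gamma> ?u"
      "counts w = (2 * K + fst (twists_vec ?u ?x), 2 * K + snd (twists_vec ?u ?x))"
      using K[of ?u] by blast
    \<comment> \<open>The other twist copies the grown entry onto the second one; this makes up for
      the factor 2 lost in \<open>curve_length_twist_le\<close>.\<close>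
    have "2 * (k * slope m ?x) \<le> total (twists_vec ?u ?x)"
      by (cases m; cases ?x) (auto simp: twists_vec_replicate)
    also have "\<dots> \<le> ?len ?u"
      using curve_length_counts[OF w(1,2)] w(3) by simp
    also have "\<dots> \<le> 2 * ?len (replicate k m)"
      using curve_length_twist_le[of ?m' "vertex_label ?\<gamma> (replicate k m)"] by simp
    finally show ?thesis by simp
  qed
  have "s = int (slope m ?x)"
  proof (rule slope_unique[of "max 1 k0" _ c _ "int ?E"])
    fix k assume "max 1 k0 \<le> k"
    then show "int (slope m ?x) * int k \<le> c + s * int k \<and>
        c + s * int k \<le> int ?E + int (slope m ?x) * int k"
      using lin[of k] upper[of k] lower[of k]
      by (simp add: mult.commute flip: of_nat_mult of_nat_add)
  qed
  with lin show ?thesis by blast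
qed

section \<open>From vertices to the asymptotic count of curves\<close>

definition same_length :: "curve \<Rightarrow> int \<Rightarrow> vertex set" where
  "same_length \<gamma> L = {u. int (curve_length (vertex_label \<gamma> u)) = L}"

definition asymptotic_count :: "(int \<Rightarrow> int) \<Rightarrow> bool" where
  "asymptotic_count f \<longleftrightarrow> (\<exists>(P::int) (Q::int) (K::int) (L\<^sub>0::int) (C :: int \<Rightarrow> int).
     P \<ge> 1 \<and> Q \<ge> 1 \<and> K \<ge> 0 \<and> L\<^sub>0 \<ge> 1 \<and> (\<forall>L. C L \<in> {-2..2}) \<and>
     (\<exists>p::int. 1 \<le> p \<and> p \<le> lcm P Q \<and> (\<forall>L. C (L + p) = C L)) \<and>
     (\<forall>L \<ge> L\<^sub>0. f L = int (phi P Q (L - 4 * K)) + C L))"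

lemma asymptotic_count_cong:
  assumes "asymptotic_count g" "\<And>L. L > N \<Longrightarrow> f L = g L"
  shows "asymptotic_count f"
proof -
  obtain P Q K L\<^sub>0 C p where *: "P \<ge> 1" "Q \<ge> 1" "K \<ge> 0" "\<forall>L. C L \<in> {-2..2}"
    "1 \<le> p \<and> p \<le> lcm P Q \<and> (\<forall>L. C (L + p) = C L)"
    "\<forall>L \<ge> L\<^sub>0. g L = int (phi P Q (L - 4 * K)) + C L"
    using assms(1) unfolding asymptotic_count_def by blast
  have "max 1 (max L\<^sub>0 (N + 1)) \<ge> 1" by simp
  moreover have "\<forall>L \<ge> max 1 (max L\<^sub>0 (N + 1)). f L = int (phi P Q (L - 4 * K)) + C L"
    using *(6) assms(2) by auto
  ultimately show ?thesis unfolding asymptotic_count_def using *(1-5) by blast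
qed

lemma asymptotic_count_positive:
  assumes adm: "admissible ps" and pos: "0 < fst (piece_counts ps)" "0 < snd (piece_counts ps)"
  defines "\<gamma> \<equiv> curve_of (stable_word ps)"
  shows "asymptotic_count (\<lambda>L. int (card (vertex_label \<gamma> ` same_length \<gamma> L)))"
proof -
  let ?x = "piece_counts ps"
  let ?f = "\<lambda>u. int (curve_length (vertex_label \<gamma> u))"
  obtain p q where x: "?x = (p, q)" by fastforce
  have pq: "0 < p" "0 < q" using pos by (simp_all add: x)
  obtain K where K: "\<And>u. TL \<in> set u \<Longrightarrow> TR \<in> set u \<Longrightarrow>
      \<exists>w. reduced (w @ w) \<and> curve_of w = vertex_label \<gamma> u \<and>
        counts w = (2 * K + fst (twists_vec u ?x), 2 * K + snd (twists_vec u ?x))"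
    using generic_representative[OF adm] unfolding piece_counts_def \<gamma>_def by blast
  have gen: "?f u = 4 * int K + int (total (twists_vec u (p, q)))" if u: "u \<in> generic" for u
  proof -
    have "TL \<in> set u" "TR \<in> set u" using u by (simp_all add: generic_def)
    then obtain w where w: "reduced (w @ w)" "curve_of w = vertex_label \<gamma> u"
      "counts w = (2 * K + fst (twists_vec u ?x), 2 * K + snd (twists_vec u ?x))"
      using K by blast
    then show ?thesis using curve_length_counts[OF w(1,2)] by (simp add: x)
  qed
  have "\<forall>m. \<exists>c k0. \<forall>k \<ge> k0. ?f (replicate k m) = c + int (slope m (p, q)) * int k"
    using curve_length_twist_power[OF adm] unfolding \<gamma>_def x by blast
  from choice[OF this] obtain c where
    pow: "\<And>m. \<exists>k0. \<forall>k \<ge> k0. ?f (replicate k m) = c m + int (slope m (p, q)) * int k"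
    by blast
  \<comment> \<open>\<open>c TL\<close> and \<open>c TR\<close> are the actual intercepts,
    \<open>4 K + p + q\<close> is that of the generic formula. Each modulus enters once with plus
    and once with minus, so both differences lie between -1 and 1.\<close>
  define C where "C L = (of_bool (int q dvd L - c TL) - of_bool (int q dvd L - (4 * int K + int p + int q)) +
    of_bool (int p dvd L - c TR) - of_bool (int p dvd L - (4 * int K + int p + int q)) :: int)" for L
  obtain L0 where L0: "\<And>L. L \<ge> L0 \<Longrightarrow>
      int (card (same_length \<gamma> L)) = int (phi (int p) (int q) (L - 4 * int K)) + C L"
    using card_vertices_eventually[OF pq gen pow] unfolding C_def same_length_def by blast
  have inj: "inj (vertex_label \<gamma>)"
    unfolding \<gamma>_def by (rule inj_vertex_label[OF adm pos])
  have "card (vertex_label \<gamma> ` same_length \<gamma> L) = card (same_length \<gamma> L)" for L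
    by (rule card_image) (rule inj_on_subset[OF inj subset_UNIV])
  with L0 have "\<forall>L \<ge> max 1 L0. int (card (vertex_label \<gamma> ` same_length \<gamma> L)) =
      int (phi (int p) (int q) (L - 4 * int K)) + C L"
    by simp
  moreover have "\<forall>L. C L \<in> {-2..2}" unfolding C_def by (simp add: of_bool_def)
  moreover have "C (L + lcm (int p) (int q)) = C L" for L
  proof -
    have "d dvd L + lcm (int p) (int q) - e \<longleftrightarrow> d dvd L - e" if "d dvd lcm (int p) (int q)" for d e
      using dvd_add_right_iff[OF that, of "L - e"] by (simp add: algebra_simps)
    then show ?thesis unfolding C_def by simp
  qed
  moreover have "1 \<le> lcm (int p) (int q)"
    using pq lcm_pos_int[of "int p" "int q"] by simp
  moreover have "int p \<ge> 1" "int q \<ge> 1" "int K \<ge> 0" "max 1 L0 \<ge> 1" using pq by simp_all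
  ultimately show ?thesis unfolding asymptotic_count_def by blast
qed

section \<open>Curves fixed by a twist\<close>

lemma twist_word_fixed:
  assumes "slope m (counts w) = 0"
  shows "twist_word m w = w"
  using assms
proof (induction w)
  case (Cons l w)
  then show ?case by (cases m; cases l) (auto simp: twist_word_Cons counts_def)
qed simp

lemma twist_curve_fixed:
  assumes "slope m (piece_counts ps) = 0"
  shows "twist_curve m (curve_of (stable_word ps)) = curve_of (stable_word ps)"
proof -
  have "slope m (counts (snd p)) = 0" if "p \<in> set ps" for p
    using assms that unfolding piece_counts_def
    by (induction ps) (cases m; auto simp: counts_def)+
  then have "map (map_prod id (twists [m])) ps = ps"
    by (intro map_idI) (auto simp: twist_word_fixed map_prod_def split_beta)
  then have "free_eq (twist_word m (stable_word ps)) (stable_word ps)"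
    using free_eq_twists_stable_word[of "[m]" ps] by simp
  then show ?thesis by (simp add: twist_curve_of curve_of_free_eq)
qed

lemma vertex_label_fixed:
  assumes "twist_curve m \<gamma> = \<gamma>"
  shows "vertex_label \<gamma> (u @ replicate k m) = vertex_label \<gamma> u"
proof -
  have "vertex_label \<gamma> (replicate k m) = \<gamma>" using assms by (induction k) auto
  then show ?thesis by simp
qed

lemma vertex_cases_trailing:
  fixes m :: twist
  assumes "m' \<noteq> m"
  obtains k where "u = replicate k m" | v k where "u = (v @ [m']) @ replicate k m"
proof (induction u arbitrary: thesis rule: rev_induct)
  case Nil
  then show ?case by (metis replicate_0)
next
  case (snoc t u)
  show ?case
  proof (cases "t = m")
    case True
    have app: "replicate k m @ [m] = replicate (Suc k) m" for k
      by (simp add: replicate_append_same)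
    show ?thesis
    proof (rule snoc.IH)
      fix k assume "u = replicate k m"
      then show ?thesis using snoc.prems(1)[of "Suc k"] True app by simp
    next
      fix v k assume "u = (v @ [m']) @ replicate k m"
      then show ?thesis using snoc.prems(2)[of v "Suc k"] True app[of k] by simp
    qed
  next
    case False
    with assms have "t = m'" by (cases t; cases m; cases m') simp_all
    then show ?thesis using snoc.prems(2)[of u 0] by simp
  qed
qed

text \<open>
  If \<open>m\<close> fixes \<open>\<gamma>\<close>, then up to trailing factors \<open>m\<close> every vertex but the root passes through the
  other child of the root, whose two letter counts are equal and positive.
\<close>

lemma asymptotic_count_fixed:
  assumes adm: "admissible ps" and zero: "slope m (piece_counts ps) = 0"
  defines "\<gamma> \<equiv> curve_of (stable_word ps)"
  shows "asymptotic_count (\<lambda>L. int (card (vertex_label \<gamma> ` same_length \<gamma> L)))"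
proof -
  define m' where "m' = (if m = TL then TR else TL)"
  define ps' where "ps' = map (map_prod id (twists [m'])) ps"
  have m': "m' \<noteq> m" by (cases m) (auto simp: m'_def)
  have fixed: "twist_curve m \<gamma> = \<gamma>" unfolding \<gamma>_def by (rule twist_curve_fixed[OF zero])
  have \<gamma>': "curve_of (stable_word ps') = twist_curve m' \<gamma>"
    using curve_of_free_eq[OF free_eq_twists_stable_word[of "[m']" ps]]
    by (simp add: \<gamma>_def ps'_def twist_curve_of)
  have "piece_counts ps' = twist_vec m' (piece_counts ps)"
    using piece_counts_twists[of "[m']" ps] by (simp add: ps'_def)
  then have pos: "0 < fst (piece_counts ps')" "0 < snd (piece_counts ps')"
    using total_piece_counts_pos[OF adm] zero
    by (cases m; cases "piece_counts ps"; simp add: m'_def)+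
  have "admissible ps'" unfolding ps'_def by (rule admissible_twists[OF adm])
  from asymptotic_count_positive[OF this pos]
  have count: "asymptotic_count (\<lambda>L. int (card
      (vertex_label (twist_curve m' \<gamma>) ` same_length (twist_curve m' \<gamma>) L)))"
    unfolding \<gamma>' .
  have child: "vertex_label \<gamma> (v @ [m']) = vertex_label (twist_curve m' \<gamma>) v" for v
    by simp
  show ?thesis
  \<comment> \<open>The powers of \<open>m\<close> are all labelled by \<open>\<gamma>\<close>
    itself, so they drop out once \<open>L\<close> exceeds its length.\<close>
  proof (rule asymptotic_count_cong[OF count, of "int (curve_length \<gamma>)"])
    fix L assume L: "L > int (curve_length \<gamma>)"
    have "vertex_label \<gamma> ` same_length \<gamma> L =
        vertex_label (twist_curve m' \<gamma>) ` same_length (twist_curve m' \<gamma>) L" (is "?A = ?B")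
    proof
      show "?A \<subseteq> ?B"
      proof
        fix \<alpha> assume "\<alpha> \<in> ?A"
        then obtain u where "u \<in> same_length \<gamma> L" "\<alpha> = vertex_label \<gamma> u" by blast
        then have u: "\<alpha> = vertex_label \<gamma> u" "int (curve_length \<alpha>) = L"
          by (simp_all add: same_length_def)
        show "\<alpha> \<in> ?B"
        proof (rule vertex_cases_trailing[OF m', of u])
          fix k assume "u = replicate k m"
          then have "\<alpha> = \<gamma>" using u(1) vertex_label_fixed[OF fixed, of "[]" k] by simp
          with u(2) L show ?thesis by simp
        next
          fix v k assume "u = (v @ [m']) @ replicate k m"
          then have "\<alpha> = vertex_label \<gamma> (v @ [m'])"
            by (simp only: u(1) vertex_label_fixed[OF fixed])
          then have \<alpha>: "\<alpha> = vertex_label (twist_curve m' \<gamma>) v" unfolding child .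
          with u(2) have "v \<in> same_length (twist_curve m' \<gamma>) L" by (simp add: same_length_def)
          with \<alpha> show ?thesis by (rule image_eqI)
        qed
      qed
      show "?B \<subseteq> ?A"
      proof
        fix \<alpha> assume "\<alpha> \<in> ?B"
        then obtain v where v: "v \<in> same_length (twist_curve m' \<gamma>) L"
          and \<alpha>: "\<alpha> = vertex_label \<gamma> (v @ [m'])"
          unfolding child by blast
        from v have "v @ [m'] \<in> same_length \<gamma> L" by (simp add: same_length_def)
        with \<alpha> show "\<alpha> \<in> ?A" by (rule image_eqI)
      qed
    qed
    then show "int (card ?A) = int (card ?B)" by (rule arg_cong)
  qed
qed

text \<open>If a twist fixes the curve, every label recurs infinitely often, so a finite set of
  vertices of one length is empty; otherwise distinct vertices have distinct labels.\<close>

lemma asymptotic_count_stable: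
  assumes "stable \<gamma>"
  shows "asymptotic_count (\<lambda>L. int (card (vertex_label \<gamma> ` same_length \<gamma> L)))"
    and "finite (same_length \<gamma> L) \<Longrightarrow>
      card (same_length \<gamma> L) = card (vertex_label \<gamma> ` same_length \<gamma> L)"
proof -
  obtain ps where adm: "admissible ps" and \<gamma>: "\<gamma> = curve_of (stable_word ps)"
    using assms stable_iff by blast
  have "asymptotic_count (\<lambda>L. int (card (vertex_label \<gamma> ` same_length \<gamma> L))) \<and>
    (finite (same_length \<gamma> L) \<longrightarrow> card (same_length \<gamma> L) = card (vertex_label \<gamma> ` same_length \<gamma> L))"
  proof (cases "\<exists>m. slope m (piece_counts ps) = 0")
    case True
    then obtain m where m: "slope m (piece_counts ps) = 0" by blast
    have fixed: "twist_curve m \<gamma> = \<gamma>" unfolding \<gamma> by (rule twist_curve_fixed[OF m])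
    have "same_length \<gamma> L = {}" if fin: "finite (same_length \<gamma> L)"
    proof (rule ccontr)
      assume "same_length \<gamma> L \<noteq> {}"
      then obtain u where "u \<in> same_length \<gamma> L" by blast
      then have "range (\<lambda>k. u @ replicate k m) \<subseteq> same_length \<gamma> L"
        by (auto simp: same_length_def vertex_label_fixed[OF fixed] simp del: vertex_label_simps)
      then have "finite (range (\<lambda>k. u @ replicate k m))" by (rule finite_subset[OF _ fin])
      moreover have "inj (\<lambda>k. u @ replicate k m)" by (simp add: inj_def)
      ultimately have "finite (UNIV :: nat set)" by (rule finite_imageD)
      then show False by simp
    qed
    then show ?thesis using asymptotic_count_fixed[OF adm m, folded \<gamma>] by auto
  next
    case False
    then have "slope m (piece_counts ps) \<noteq> 0" for m by simp
    from this[of TL] this[of TR]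
    have pos: "0 < fst (piece_counts ps)" "0 < snd (piece_counts ps)" by simp_all
    have inj: "inj (vertex_label \<gamma>)" unfolding \<gamma> by (rule inj_vertex_label[OF adm pos])
    have "card (vertex_label \<gamma> ` same_length \<gamma> L) = card (same_length \<gamma> L)"
      by (rule card_image) (rule inj_on_subset[OF inj subset_UNIV])
    then show ?thesis using asymptotic_count_positive[OF adm pos, folded \<gamma>] by simp
  qed
  then show "asymptotic_count (\<lambda>L. int (card (vertex_label \<gamma> ` same_length \<gamma> L)))"
    and "finite (same_length \<gamma> L) \<Longrightarrow>
      card (same_length \<gamma> L) = card (vertex_label \<gamma> ` same_length \<gamma> L)"
    by blast+
qed

theorem theorem1p7:
  fixes \<gamma> :: curve and \<Gamma> :: "vertex set"
  assumes "essential \<gamma>"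
    and "maximal_stable_subtree \<gamma> \<Gamma>"
  shows "\<exists>(P::int) (Q::int) (K::int) (L\<^sub>0::int) (C :: int \<Rightarrow> int).
           P \<ge> 1 \<and> Q \<ge> 1 \<and> K \<ge> 0 \<and> L\<^sub>0 \<ge> 1 \<and>
           (\<forall>L. C L \<in> {-2..2}) \<and>
           (\<exists>p::int. 1 \<le> p \<and> p \<le> lcm P Q \<and> (\<forall>L. C (L + p) = C L)) \<and>
           (\<forall>L \<ge> L\<^sub>0.
              int (card (vertex_label \<gamma> ` vertices_of_length \<gamma> \<Gamma> L)) = int (phi P Q (L - 4 * K)) + C L \<and>
              (finite (vertices_of_length \<gamma> \<Gamma> L) \<longrightarrow>
                 int (card (vertices_of_length \<gamma> \<Gamma> L)) = int (phi P Q (L - 4 * K)) + C L))"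
proof -
  obtain v where \<Gamma>: "\<Gamma> = range (\<lambda>u. u @ v)" and st: "stable (vertex_label \<gamma> v)"
    using assms(2) by (rule maximal_stable_subtree_eq)
  let ?\<delta> = "vertex_label \<gamma> v"
  \<comment> \<open>\<open>\<Gamma>\<close> is a copy of the whole tree of the stable curve
    \<open>?\<delta>\<close>, so its count is that of all vertices below this curve.\<close>
  have verts: "vertices_of_length \<gamma> \<Gamma> L = (\<lambda>u. u @ v) ` same_length ?\<delta> L" for L
    by (auto simp: vertices_of_length_def \<Gamma> same_length_def)
  have labels: "vertex_label \<gamma> ` vertices_of_length \<gamma> \<Gamma> L = vertex_label ?\<delta> ` same_length ?\<delta> L" for L
    unfolding verts image_image by simp
  have inj: "inj_on (\<lambda>u. u @ v) S" for S by (simp add: inj_on_def)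
  have card: "card (vertices_of_length \<gamma> \<Gamma> L) = card (vertex_label \<gamma> ` vertices_of_length \<gamma> \<Gamma> L)"
    if "finite (vertices_of_length \<gamma> \<Gamma> L)" for L
    using asymptotic_count_stable(2)[OF st, of L] that
    by (simp add: verts card_image[OF inj] finite_image_iff[OF inj] image_image)
  have "asymptotic_count (\<lambda>L. int (card (vertex_label \<gamma> ` vertices_of_length \<gamma> \<Gamma> L)))"
    unfolding labels by (rule asymptotic_count_stable(1)[OF st])
  then obtain P Q K L\<^sub>0 C p where *: "P \<ge> 1" "Q \<ge> 1" "K \<ge> 0" "L\<^sub>0 \<ge> 1" "\<forall>L. C L \<in> {-2..2}"
    "1 \<le> p \<and> p \<le> lcm P Q \<and> (\<forall>L. C (L + p) = C L)"
    "\<forall>L \<ge> L\<^sub>0. int (card (vertex_label \<gamma> ` vertices_of_length \<gamma> \<Gamma> L)) = int (phi P Q (L - 4 * K)) + C L"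
    unfolding asymptotic_count_def by blast
  have "\<exists>p::int. 1 \<le> p \<and> p \<le> lcm P Q \<and> (\<forall>L. C (L + p) = C L)" using *(6) by blast
  moreover have "\<forall>L \<ge> L\<^sub>0.
      int (card (vertex_label \<gamma> ` vertices_of_length \<gamma> \<Gamma> L)) = int (phi P Q (L - 4 * K)) + C L \<and>
      (finite (vertices_of_length \<gamma> \<Gamma> L) \<longrightarrow>
         int (card (vertices_of_length \<gamma> \<Gamma> L)) = int (phi P Q (L - 4 * K)) + C L)"
    using *(7) card by presburger
  ultimately show ?thesis using *(1-5) by blast
qed

end
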